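(* Let $\mathcal{M}$ be an $\aleph_1$-saturated structure, with domain $M$, in a countable first-order language $L$. Let $V=\{1,\ldots,n\}$, $J=\{1,\ldots,n-1\}\subseteq V$, and let $\mathcal{J}$ be the set of $(n-1)$-element subsets of $V$. Let $\nu=\nu^V$ be a probability measure on $\mathcal{B}_V$ which satisfies the Definability and Fubini conditions. Suppose $E\in\mathcal{B}_V$ is such that: (a) $\nu^J(\pi_J(E))>0$; (b) there is $l\in\mathbb{N}$ such that for all $I\in\mathcal{J}$ and $\bar a\in M^I$, the set $\pi_I^{-1}(\bar a)\cap E$ has at most $l$ elements; (c) there is a real number $k>0$ such that if $F\in\mathcal{B}^0_V$, then $\nu^J(\pi_J(F\cap E))\le k\,\nu^I(\pi_I(F\cap E))$ for all $I\in\mathcal{J}$. Then $$\nu^V\big(\{\bar b\in M^V : \pi_I(\bar b)\in\pi_I(E)\ \text{for all } I\in\mathcal{J}\}\big)>0.$$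
   Context: For a finite index set $U$, $M^U$ denotes the set of functions $U\to M$ (if $\mathcal M$ is multi-sorted, each index is associated with a particular sort and takes values in it). For $I\subseteq V$, $\mathcal{B}^0_I$ is the Boolean algebra of subsets of $M^I$ definable in $\mathcal{M}$ with parameters from $M$, and $\mathcal{B}_I$ is the $\sigma$-algebra generated by $\mathcal{B}^0_I$. The map $\pi_I: M^V\to M^I$ is the projection (restriction) map, and $\nu^I$ is the push-forward of $\nu$ to $\mathcal{B}_I$, i.e. $\nu^I(A)=\nu(\pi_I^{-1}(A))$. For $B\subseteq M^V$, $K\subseteq V$ and $\bar a_K\in M^K$, the fibre is $B(\bar a_K)=\{\bar a\in M^{V\setminus K} : \bar a\cup\bar a_K\in B\}$. Definability condition: for all $K\subseteq V$ and $B\in\mathcal{B}_V$, the function $\bar x_K\mapsto \nu^{V\setminus K}(B(\bar x_K))$ on $M^K$ is $\mathcal{B}_K$-measurable. Fubini condition: for all $K\subseteq V$ and $f\in L^\infty(\nu^V)$ (i.e. $f: M^V\to\mathbb{R}$ is $\mathcal{B}_V$-measurable and essentially bounded), $\int f\,d\nu^V=\int\int f\,d\nu^K\,d\nu^{V\setminus K}$. *)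

theory Defs
  imports "HOL-Probability.Probability"
begin

section \<open>Many-sorted first-order logic\<close>

text \<open>
  A one-sorted language is one in which \<open>sorts\<close> is a singleton. Constant symbols are the function
  symbols with an empty list of argument sorts.
\<close>

record ('s, 'f, 'r) lang =
  sorts :: "'s set"
  funs :: "'f set"
  rels :: "'r set"
  fun_args :: "'f \<Rightarrow> 's list"
  fun_res :: "'f \<Rightarrow> 's"
  rel_args :: "'r \<Rightarrow> 's list"

definition countable_language :: "('s, 'f, 'r) lang \<Rightarrow> bool" where
  "countable_language L \<longleftrightarrow>
     countable (sorts L) \<and> countable (funs L) \<and> countable (rels L) \<and>
     (\<forall>f\<in>funs L. set (fun_args L f) \<subseteq> sorts L \<and> fun_res L f \<in> sorts L) \<and>
     (\<forall>r\<in>rels L. set (rel_args L r) \<subseteq> sorts L)"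

record ('s, 'f, 'r, 'a) struct =
  domain :: "'s \<Rightarrow> 'a set"
  fun_int :: "'f \<Rightarrow> 'a list \<Rightarrow> 'a"
  rel_int :: "'r \<Rightarrow> 'a list \<Rightarrow> bool"

definition is_structure :: "('s, 'f, 'r) lang \<Rightarrow> ('s, 'f, 'r, 'a) struct \<Rightarrow> bool" where
  "is_structure L M \<longleftrightarrow>
     (\<forall>s\<in>sorts L. domain M s \<noteq> {}) \<and>
     (\<forall>f\<in>funs L. \<forall>as. list_all2 (\<lambda>a s. a \<in> domain M s) as (fun_args L f) \<longrightarrow>
        fun_int M f as \<in> domain M (fun_res L f))"

text \<open>
  A variable is a pair of a sort and a number. \<open>Par s a\<close> is the constant naming the element \<open>a\<close> of
  sort \<open>s\<close>, so that a parameter set is a set of pairs \<open>(s, a)\<close>; elements are tagged with their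
  sort because the domains of different sorts need not be disjoint.
\<close>

datatype ('s, 'f, 'a) tm =
    Var "'s \<times> nat"
  | Par 's 'a
  | Fn 'f "('s, 'f, 'a) tm list"

datatype ('s, 'f, 'r, 'a) fm =
    Eq "('s, 'f, 'a) tm" "('s, 'f, 'a) tm"
  | Rel 'r "('s, 'f, 'a) tm list"
  | Neg "('s, 'f, 'r, 'a) fm"
  | Conj "('s, 'f, 'r, 'a) fm" "('s, 'f, 'r, 'a) fm"
  | Exi "'s \<times> nat" "('s, 'f, 'r, 'a) fm"

text \<open>
  \<open>is_tm L A t s\<close> and \<open>is_fm L A \<phi>\<close>: \<open>t\<close> is a term of sort \<open>s\<close>, and \<open>\<phi>\<close> is a formula, of the
  language \<open>L(A)\<close> that expands \<open>L\<close> by constants for the elements of \<open>A\<close>.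
\<close>

inductive is_tm :: "('s, 'f, 'r) lang \<Rightarrow> ('s \<times> 'a) set \<Rightarrow> ('s, 'f, 'a) tm \<Rightarrow> 's \<Rightarrow> bool"
  for L A where
  var: "s \<in> sorts L \<Longrightarrow> is_tm L A (Var (s, i)) s"
| par: "(s, a) \<in> A \<Longrightarrow> is_tm L A (Par s a) s"
| fn: "f \<in> funs L \<Longrightarrow> list_all2 (is_tm L A) ts (fun_args L f) \<Longrightarrow>
    is_tm L A (Fn f ts) (fun_res L f)"

primrec is_fm :: "('s, 'f, 'r) lang \<Rightarrow> ('s \<times> 'a) set \<Rightarrow> ('s, 'f, 'r, 'a) fm \<Rightarrow> bool" where
  "is_fm L A (Eq t u) \<longleftrightarrow> (\<exists>s. is_tm L A t s \<and> is_tm L A u s)"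
| "is_fm L A (Rel r ts) \<longleftrightarrow> r \<in> rels L \<and> list_all2 (is_tm L A) ts (rel_args L r)"
| "is_fm L A (Neg \<phi>) \<longleftrightarrow> is_fm L A \<phi>"
| "is_fm L A (Conj \<phi> \<psi>) \<longleftrightarrow> is_fm L A \<phi> \<and> is_fm L A \<psi>"
| "is_fm L A (Exi v \<phi>) \<longleftrightarrow> fst v \<in> sorts L \<and> is_fm L A \<phi>"

primrec vars_tm :: "('s, 'f, 'a) tm \<Rightarrow> ('s \<times> nat) set" where
  "vars_tm (Var v) = {v}"
| "vars_tm (Par s a) = {}"
| "vars_tm (Fn f ts) = \<Union> (set (map vars_tm ts))"

primrec free_vars :: "('s, 'f, 'r, 'a) fm \<Rightarrow> ('s \<times> nat) set" where
  "free_vars (Eq t u) = vars_tm t \<union> vars_tm u"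
| "free_vars (Rel r ts) = \<Union> (set (map vars_tm ts))"
| "free_vars (Neg \<phi>) = free_vars \<phi>"
| "free_vars (Conj \<phi> \<psi>) = free_vars \<phi> \<union> free_vars \<psi>"
| "free_vars (Exi v \<phi>) = free_vars \<phi> - {v}"

primrec eval_tm :: "('s, 'f, 'r, 'a) struct \<Rightarrow> ('s \<times> nat \<Rightarrow> 'a) \<Rightarrow> ('s, 'f, 'a) tm \<Rightarrow> 'a" where
  "eval_tm M e (Var v) = e v"
| "eval_tm M e (Par s a) = a"
| "eval_tm M e (Fn f ts) = fun_int M f (map (eval_tm M e) ts)"

primrec sat :: "('s, 'f, 'r, 'a) struct \<Rightarrow> ('s \<times> nat \<Rightarrow> 'a) \<Rightarrow> ('s, 'f, 'r, 'a) fm \<Rightarrow> bool" where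
  "sat M e (Eq t u) \<longleftrightarrow> eval_tm M e t = eval_tm M e u"
| "sat M e (Rel r ts) \<longleftrightarrow> rel_int M r (map (eval_tm M e) ts)"
| "sat M e (Neg \<phi>) \<longleftrightarrow> \<not> sat M e \<phi>"
| "sat M e (Conj \<phi> \<psi>) \<longleftrightarrow> sat M e \<phi> \<and> sat M e \<psi>"
| "sat M e (Exi v \<phi>) \<longleftrightarrow> (\<exists>a\<in>domain M (fst v). sat M (e(v := a)) \<phi>)"

definition elements :: "('s, 'f, 'r) lang \<Rightarrow> ('s, 'f, 'r, 'a) struct \<Rightarrow> ('s \<times> 'a) set" where
  "elements L M = (SIGMA s:sorts L. domain M s)"

text \<open>
  Every type over a countable parameter set, in finitely many variables \<open>X\<close>, is realized. A type is
  given as a set \<open>p\<close> of formulas that is finitely satisfiable in \<open>M\<close>; by compactness this is the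
  same as consistency with the elementary diagram of \<open>M\<close>.
\<close>

definition aleph1_saturated :: "('s, 'f, 'r) lang \<Rightarrow> ('s, 'f, 'r, 'a) struct \<Rightarrow> bool" where
  "aleph1_saturated L M \<longleftrightarrow>
     (\<forall>A X p. countable A \<longrightarrow> A \<subseteq> elements L M \<longrightarrow> finite X \<longrightarrow> X \<subseteq> sorts L \<times> UNIV \<longrightarrow>
        (\<forall>\<phi>\<in>p. is_fm L A \<phi> \<and> free_vars \<phi> \<subseteq> X) \<longrightarrow>
        (\<forall>q. finite q \<longrightarrow> q \<subseteq> p \<longrightarrow> (\<exists>e \<in> Pi X (domain M \<circ> fst). \<forall>\<phi>\<in>q. sat M e \<phi>)) \<longrightarrow>
        (\<exists>e \<in> Pi X (domain M \<circ> fst). \<forall>\<phi>\<in>p. sat M e \<phi>))"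


section \<open>Definable sets and measures\<close>

text \<open>
  The index \<open>i\<close> takes values in the sort \<open>\<sigma> i\<close>. Tuples are extensional functions, as in
  \<^term>\<open>PiM\<close>; so the projection to \<open>I\<close> is \<^term>\<open>\<lambda>x. restrict x I\<close>, and the union of tuples
  indexed by disjoint sets \<open>K\<close> and \<open>K'\<close> is \<^term>\<open>\<lambda>x y. merge K K' (x, y)\<close>.
\<close>

definition tuples :: "('s, 'f, 'r, 'a) struct \<Rightarrow> (nat \<Rightarrow> 's) \<Rightarrow> nat set \<Rightarrow> (nat \<Rightarrow> 'a) set" where
  "tuples M \<sigma> I = (\<Pi>\<^sub>E i\<in>I. domain M (\<sigma> i))"

abbreviation proj :: "nat set \<Rightarrow> (nat \<Rightarrow> 'a) \<Rightarrow> (nat \<Rightarrow> 'a)" where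
  "proj I x \<equiv> restrict x I"

text \<open>The coordinate \<open>i\<close> of a tuple is the value of the variable \<open>(\<sigma> i, i)\<close>.\<close>

definition definable_sets ::
  "('s, 'f, 'r) lang \<Rightarrow> ('s, 'f, 'r, 'a) struct \<Rightarrow> (nat \<Rightarrow> 's) \<Rightarrow> nat set \<Rightarrow> (nat \<Rightarrow> 'a) set set" where
  "definable_sets L M \<sigma> I =
     {{x \<in> tuples M \<sigma> I. sat M (\<lambda>(s, i). x i) \<phi>} |\<phi>.
        is_fm L (elements L M) \<phi> \<and> free_vars \<phi> \<subseteq> (\<lambda>i. (\<sigma> i, i)) ` I}"

text \<open>The measure of \<^const>\<open>sigma\<close> is irrelevant here; only its space and sets matter.\<close>

definition definable_algebra ::
  "('s, 'f, 'r) lang \<Rightarrow> ('s, 'f, 'r, 'a) struct \<Rightarrow> (nat \<Rightarrow> 's) \<Rightarrow> nat set \<Rightarrow> (nat \<Rightarrow> 'a) measure" where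
  "definable_algebra L M \<sigma> I = sigma (tuples M \<sigma> I) (definable_sets L M \<sigma> I)"

definition marginal ::
  "('s, 'f, 'r) lang \<Rightarrow> ('s, 'f, 'r, 'a) struct \<Rightarrow> (nat \<Rightarrow> 's) \<Rightarrow> (nat \<Rightarrow> 'a) measure \<Rightarrow>
    nat set \<Rightarrow> (nat \<Rightarrow> 'a) measure" where
  "marginal L M \<sigma> \<nu> I = distr \<nu> (definable_algebra L M \<sigma> I) (proj I)"

definition fibre ::
  "('s, 'f, 'r, 'a) struct \<Rightarrow> (nat \<Rightarrow> 's) \<Rightarrow> nat set \<Rightarrow> nat set \<Rightarrow> (nat \<Rightarrow> 'a) set \<Rightarrow>
    (nat \<Rightarrow> 'a) \<Rightarrow> (nat \<Rightarrow> 'a) set" where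
  "fibre M \<sigma> V K B a = {x \<in> tuples M \<sigma> (V - K). merge (V - K) K (x, a) \<in> B}"

definition definability_condition ::
  "('s, 'f, 'r) lang \<Rightarrow> ('s, 'f, 'r, 'a) struct \<Rightarrow> (nat \<Rightarrow> 's) \<Rightarrow> nat set \<Rightarrow>
    (nat \<Rightarrow> 'a) measure \<Rightarrow> bool" where
  "definability_condition L M \<sigma> V \<nu> \<longleftrightarrow>
     (\<forall>K B. K \<subseteq> V \<longrightarrow> B \<in> sets (definable_algebra L M \<sigma> V) \<longrightarrow>
        (\<lambda>a. measure (marginal L M \<sigma> \<nu> (V - K)) (fibre M \<sigma> V K B a))
          \<in> borel_measurable (definable_algebra L M \<sigma> K))"

text \<open>
  The inner integral need only exist for almost all \<open>y\<close>; for the others the Bochner integral is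
  \<open>0\<close> by convention, which does not affect the outer one.
\<close>

definition fubini_condition ::
  "('s, 'f, 'r) lang \<Rightarrow> ('s, 'f, 'r, 'a) struct \<Rightarrow> (nat \<Rightarrow> 's) \<Rightarrow> nat set \<Rightarrow>
    (nat \<Rightarrow> 'a) measure \<Rightarrow> bool" where
  "fubini_condition L M \<sigma> V \<nu> \<longleftrightarrow>
     (\<forall>K (f :: (nat \<Rightarrow> 'a) \<Rightarrow> real). K \<subseteq> V \<longrightarrow>
        f \<in> borel_measurable (definable_algebra L M \<sigma> V) \<longrightarrow>
        (\<exists>C. AE x in \<nu>. \<bar>f x\<bar> \<le> C) \<longrightarrow>
        (\<integral>x. f x \<partial>\<nu>) =
          (\<integral>y. (\<integral>x. f (merge K (V - K) (x, y)) \<partial>marginal L M \<sigma> \<nu> K)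
             \<partial>marginal L M \<sigma> \<nu> (V - K)))"

end

theory Submission
  imports Defs
begin

text \<open>
  Put \<open>\<mu> X = \<nu>\<^sup>J (\<pi>\<^sub>J (X \<inter> E))\<close> for \<open>X\<close> in \<open>B\<^sub>V\<close>. This is a submeasure that lives on \<open>E\<close>, while \<open>E\<close> itself may well
  be \<open>\<nu>\<close>-null. With \<open>A\<^sub>I = \<pi>\<^sub>I\<^sup>-\<^sup>1 (\<pi>\<^sub>I E)\<close>, the set in question is the intersection of the \<open>A\<^sub>I\<close>; it contains \<open>E\<close>,
  so by (a) its \<open>\<mu>\<close>-measure is positive. It remains to see that \<open>\<mu>\<close> vanishes on it if \<open>\<nu>\<close> does.

  Hypothesis (c) links the two: \<open>\<mu> X \<le> k \<nu> X\<close> if \<open>X\<close> depends only on the coordinates in some \<open>I \<in> \<J>\<close>. It is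
  assumed for definable sets, and since \<open>E\<close> has finite fibres, projections of \<open>X \<inter> E\<close> commute with decreasing
  as well as with increasing limits in \<open>X\<close>, so it extends to \<open>B\<^sub>V\<close> (\<open>image_measure_le\<close>). Every submeasure
  linked to \<open>\<nu>\<close> in this way vanishes on every \<open>\<nu>\<close>-null intersection of sets \<open>A\<^sub>I\<close> in \<open>I\<close>-coordinates (\<open>removal\<close>).
  This is a measure-theoretic hypergraph removal lemma.

  Its proof lowers the complexity of the \<open>A\<^sub>I\<close>. Let \<open>L\<^sub>j I\<close> be the \<open>\<sigma>\<close>-algebra generated by sets that depend on
  at most \<open>j\<close> coordinates in \<open>I\<close>, and suppose that the \<open>A\<^sub>I\<close> are in \<open>L\<^sub>j\<^sub>+\<^sub>1 I\<close>. Up to small sets, each \<open>A\<^sub>I\<close> is a union of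
  cells, intersections of sets in \<open>j + 1\<close> coordinates, in which it is dense relative to \<open>L\<^sub>j I\<close>. Consider a
  cell in which all of them are dense. The density of \<open>A\<^sub>I\<close> relative to \<open>L\<^sub>j I\<close> does not change when the cell is
  cut by sets that share at most \<open>j\<close> coordinates with \<open>I\<close>, by the Fubini condition: with the coordinates outside
  \<open>I\<close> fixed, such a set is in \<open>L\<^sub>j I\<close> (\<open>orthogonal\<close>). Hence all \<open>A\<^sub>I\<close> are dense in one and the same cell and
  intersect in a set of positive measure unless the cell is null. In the null case the supports of the
  conditional expectations of the sides of the cell give sets in \<open>L\<^sub>j I\<close> with a null intersection, and \<open>\<mu>\<close>
  vanishes on that by induction (\<open>cell_null\<close>). For \<open>j = 0\<close> all sets are trivial.

  For all this to make sense, \<open>\<pi>\<^sub>I (X \<inter> E)\<close> must be measurable. This is where saturation and the bound in (b)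
  come in (\<open>finite_to_one_image\<close>). A point of \<open>E\<close> has finitely many conjugates over its projection and over
  countably many parameters defining \<open>E\<close>; so by compactness it is isolated, up to finitely many types, in its
  fibre by a single definable set. This splits \<open>E\<close> into countably many pieces on which projection commutes
  with monotone limits.
\<close>

section \<open>Monotone classes and finite approximation\<close>

inductive_set monotone_class :: "'x set set \<Rightarrow> 'x set set" for \<A> where
  basic: "A \<in> \<A> \<Longrightarrow> A \<in> monotone_class \<A>"
| inc: "(\<And>i::nat. X i \<in> monotone_class \<A>) \<Longrightarrow> incseq X \<Longrightarrow> (\<Union>i. X i) \<in> monotone_class \<A>"
| dec: "(\<And>i::nat. X i \<in> monotone_class \<A>) \<Longrightarrow> decseq X \<Longrightarrow> (\<Inter>i. X i) \<in> monotone_class \<A>"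

lemma (in algebra) monotone_class_Diff:
  assumes "B \<in> monotone_class M"
  shows "\<Omega> - B \<in> monotone_class M"
  using assms
proof induction
  case (basic A)
  then show ?case by (auto intro: monotone_class.basic)
next
  case (inc X)
  have "\<Omega> - (\<Union>i. X i) = (\<Inter>i. \<Omega> - X i)" by auto
  moreover have "decseq (\<lambda>i. \<Omega> - X i)"
    using \<open>incseq X\<close> by (auto simp: decseq_def incseq_def)
  ultimately show ?case using monotone_class.dec[OF inc.IH] by simp
next
  case (dec X)
  have "\<Omega> - (\<Inter>i. X i) = (\<Union>i. \<Omega> - X i)" by auto
  moreover have "incseq (\<lambda>i. \<Omega> - X i)"
    using \<open>decseq X\<close> by (auto simp: decseq_def incseq_def)
  ultimately show ?case using monotone_class.inc[OF dec.IH] by simp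
qed

lemma monotone_class_Int_fixed:
  assumes "B \<in> monotone_class M"
    and base: "\<And>A. A \<in> M \<Longrightarrow> C \<inter> A \<in> monotone_class M"
  shows "C \<inter> B \<in> monotone_class M"
  using assms(1)
proof induction
  case (basic A)
  then show ?case by (rule base)
next
  case (inc X)
  have "C \<inter> (\<Union>i. X i) = (\<Union>i. C \<inter> X i)" by auto
  moreover have "incseq (\<lambda>i. C \<inter> X i)"
    using \<open>incseq X\<close> by (auto simp: incseq_def)
  ultimately show ?case using monotone_class.inc[OF inc.IH] by simp
next
  case (dec X)
  have "C \<inter> (\<Inter>i. X i) = (\<Inter>i. C \<inter> X i)" by auto
  moreover have "decseq (\<lambda>i. C \<inter> X i)"
    using \<open>decseq X\<close> by (auto simp: decseq_def)
  ultimately show ?case using monotone_class.dec[OF dec.IH] by simp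
qed

lemma (in algebra) monotone_class_Int:
  assumes "A \<in> monotone_class M" "B \<in> monotone_class M"
  shows "A \<inter> B \<in> monotone_class M"
proof (rule monotone_class_Int_fixed[OF assms(2)])
  fix C assume "C \<in> M"
  then have "C \<inter> A \<in> monotone_class M"
    by (intro monotone_class_Int_fixed[OF assms(1)]) (auto intro: monotone_class.basic)
  then show "A \<inter> C \<in> monotone_class M" by (simp add: Int_commute)
qed

lemma (in algebra) monotone_class_into_space:
  assumes "B \<in> monotone_class M" shows "B \<subseteq> \<Omega>"
  using assms by induction (use sets_into_space in \<open>auto simp: subset_eq\<close>)

lemma (in algebra) sigma_sets_subset_monotone_class: "sigma_sets \<Omega> M \<subseteq> monotone_class M"
proof
  fix B assume "B \<in> sigma_sets \<Omega> M"
  then show "B \<in> monotone_class M"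
  proof induction
    case (Basic a) then show ?case by (rule monotone_class.basic)
  next
    case Empty then show ?case by (auto intro: monotone_class.basic)
  next
    case (Compl a) then show ?case by (auto intro: monotone_class_Diff)
  next
    case (Union a)
    have Un: "A \<union> B \<in> monotone_class M"
      if "A \<in> monotone_class M" "B \<in> monotone_class M" for A B
    proof -
      have "A \<union> B = \<Omega> - ((\<Omega> - A) \<inter> (\<Omega> - B))"
        using monotone_class_into_space that by blast
      then show ?thesis using that monotone_class_Diff monotone_class_Int by metis
    qed
    have "(\<Union>i\<le>n. a i) \<in> monotone_class M" for n
      by (induction n) (auto simp: atMost_Suc intro!: Un Union)
    moreover have "incseq (\<lambda>n. \<Union>i\<le>n. a i)"
      by (intro monoI UN_mono) auto
    ultimately have "(\<Union>n. \<Union>i\<le>n. a i) \<in> monotone_class M" by (rule monotone_class.inc)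
    moreover have "(\<Union>n. \<Union>i\<le>n. a i) = (\<Union>i. a i)" by auto
    ultimately show ?case by simp
  qed
qed

text \<open>Inequalities between measures and measurability of images do not pass to complements, so
  they cannot be proved by induction over \<^const>\<open>sigma_sets\<close>; along monotone limits they do carry
  over from an algebra to the \<open>\<sigma>\<close>-algebra that it generates.\<close>

lemma (in algebra) monotone_class_induct [consumes 1, case_names basic inc dec]:
  assumes "B \<in> sigma_sets \<Omega> M"
    and basic: "\<And>A. A \<in> M \<Longrightarrow> P A"
    and inc: "\<And>X. (\<And>i::nat. X i \<in> sigma_sets \<Omega> M) \<Longrightarrow> (\<And>i. P (X i)) \<Longrightarrow> incseq X \<Longrightarrow> P (\<Union>i. X i)"
    and dec: "\<And>X. (\<And>i::nat. X i \<in> sigma_sets \<Omega> M) \<Longrightarrow> (\<And>i. P (X i)) \<Longrightarrow> decseq X \<Longrightarrow> P (\<Inter>i. X i)"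
  shows "P B"
proof -
  have "B \<in> monotone_class M" using assms(1) sigma_sets_subset_monotone_class by auto
  then have "B \<in> sigma_sets \<Omega> M \<and> P B"
  proof induction
    case (inc X) then show ?case using assms(3)[of X] by (auto intro: sigma_sets.Union)
  next
    case (dec X) then show ?case using assms(4)[of X]
      using sigma_sets_INTER[OF space_closed, of UNIV X] by auto
  qed (auto intro: basic)
  then show ?thesis by simp
qed

text \<open>\<open>R\<close> is a union of cells of the partition of \<open>\<Omega>\<close> that \<open>G\<close> induces. For finite \<open>G\<close> this
  says that \<open>R\<close> is a Boolean combination of members of \<open>G\<close>, without choosing one.\<close>

definition determined_by :: "'x set \<Rightarrow> 'x set set \<Rightarrow> 'x set \<Rightarrow> bool" where
  "determined_by \<Omega> G R \<longleftrightarrow>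
     R \<subseteq> \<Omega> \<and> (\<forall>x\<in>\<Omega>. \<forall>y\<in>\<Omega>. (\<forall>c\<in>G. x \<in> c \<longleftrightarrow> y \<in> c) \<longrightarrow> x \<in> R \<longrightarrow> y \<in> R)"

lemma determined_byD:
  "determined_by \<Omega> G R \<Longrightarrow> x \<in> R \<Longrightarrow> y \<in> \<Omega> \<Longrightarrow> (\<And>c. c \<in> G \<Longrightarrow> x \<in> c \<longleftrightarrow> y \<in> c) \<Longrightarrow> y \<in> R"
  unfolding determined_by_def by blast

lemma determined_byI:
  assumes "R \<subseteq> \<Omega>"
    and "\<And>x y. x \<in> R \<Longrightarrow> y \<in> \<Omega> \<Longrightarrow> (\<And>c. c \<in> G \<Longrightarrow> x \<in> c \<longleftrightarrow> y \<in> c) \<Longrightarrow> y \<in> R"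
  shows "determined_by \<Omega> G R"
  unfolding determined_by_def
proof (intro conjI ballI impI)
  fix x y assume "x \<in> R" "y \<in> \<Omega>" "\<forall>c\<in>G. x \<in> c \<longleftrightarrow> y \<in> c"
  then show "y \<in> R" using assms(2)[of x y] by simp
qed (rule assms(1))

lemma determined_by_mono: "determined_by \<Omega> G R \<Longrightarrow> G \<subseteq> G' \<Longrightarrow> determined_by \<Omega> G' R"
  unfolding determined_by_def by blast

lemma algebra_finitely_determined:
  "algebra \<Omega> {R. \<exists>G. finite G \<and> G \<subseteq> \<G> \<and> determined_by \<Omega> G R}" (is "algebra _ ?A")
  unfolding algebra_iff_Un
proof (intro conjI ballI)
  show "?A \<subseteq> Pow \<Omega>" by (auto simp: determined_by_def)
  show "{} \<in> ?A" by (auto simp: determined_by_def)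
next
  fix a assume "a \<in> ?A"
  then obtain G where G: "finite G" "G \<subseteq> \<G>" "determined_by \<Omega> G a" by auto
  have "determined_by \<Omega> G (\<Omega> - a)"
    unfolding determined_by_def using determined_byD[OF G(3)] by fast
  with G show "\<Omega> - a \<in> ?A" by auto
next
  fix a b assume "a \<in> ?A" "b \<in> ?A"
  then obtain G H where G: "finite G" "G \<subseteq> \<G>" "determined_by \<Omega> G a"
    and H: "finite H" "H \<subseteq> \<G>" "determined_by \<Omega> H b" by auto
  have "determined_by \<Omega> (G \<union> H) (a \<union> b)"
  proof (rule determined_byI)
    show "a \<union> b \<subseteq> \<Omega>" using G(3) H(3) by (auto simp: determined_by_def)
    show "y \<in> a \<union> b"
      if "x \<in> a \<union> b" "y \<in> \<Omega>" "\<And>c. c \<in> G \<union> H \<Longrightarrow> x \<in> c \<longleftrightarrow> y \<in> c" for x y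
      using that determined_byD[OF G(3), of x y] determined_byD[OF H(3), of x y] by auto
  qed
  with G H show "a \<union> b \<in> ?A" by (intro CollectI exI[of _ "G \<union> H"]) auto
qed

text \<open>The finitely determined sets are the algebra generated by \<open>\<G>\<close>, so monotone class arguments become
available for the \<open>\<sigma>\<close>-algebra that an arbitrary family generates.\<close>

lemma sigma_sets_finitely_determined:
  assumes "\<G> \<subseteq> Pow \<Omega>" "B \<in> sigma_sets \<Omega> \<G>"
  shows "B \<in> sigma_sets \<Omega> {R. \<exists>G. finite G \<and> G \<subseteq> \<G> \<and> determined_by \<Omega> G R}"
proof -
  have "c \<in> {R. \<exists>G. finite G \<and> G \<subseteq> \<G> \<and> determined_by \<Omega> G R}" if "c \<in> \<G>" for c
    using that assms(1) by (auto simp: determined_by_def intro!: exI[of _ "{c}"])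
  then have "\<G> \<subseteq> {R. \<exists>G. finite G \<and> G \<subseteq> \<G> \<and> determined_by \<Omega> G R}" by (rule subsetI)
  from sigma_sets_mono'[OF this] assms(2) show ?thesis by (rule subsetD)
qed

lemma (in algebra) determined_by_in_sets:
  assumes "finite G" "G \<subseteq> M" "determined_by \<Omega> G R"
  shows "R \<in> M"
proof -
  define cell where "cell s = {x \<in> \<Omega>. \<forall>c\<in>G. x \<in> c \<longleftrightarrow> c \<in> s}" for s
  define S where "S = (\<lambda>x. {c \<in> G. x \<in> c}) ` R"
  have "finite S" using assms(1) by (auto simp: S_def intro: finite_subset[of _ "Pow G"])
  have "cell s \<in> M" for s
  proof -
    have "{x \<in> \<Omega>. x \<in> c \<longleftrightarrow> c \<in> s} \<in> M" if "c \<in> G" for c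
    proof -
      have "{x \<in> \<Omega>. x \<in> c \<longleftrightarrow> c \<in> s} = (if c \<in> s then c else \<Omega> - c)"
        using that assms(2) sets_into_space by auto
      then show ?thesis using that assms(2) by auto
    qed
    then show ?thesis unfolding cell_def using assms(1) by (intro sets_Collect_finite_All) auto
  qed
  then have "(\<Union>s\<in>S. cell s) \<in> M" using \<open>finite S\<close> by auto
  moreover have "(\<Union>s\<in>S. cell s) = R"
  proof
    show "(\<Union>s\<in>S. cell s) \<subseteq> R"
    proof
      fix y assume "y \<in> (\<Union>s\<in>S. cell s)"
      then obtain x where "x \<in> R" "y \<in> cell {c \<in> G. x \<in> c}" by (auto simp: S_def)
      then show "y \<in> R" using determined_byD[OF assms(3), of x y] by (auto simp: cell_def)
    qed
    show "R \<subseteq> (\<Union>s\<in>S. cell s)"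
      using assms(3) by (auto simp: S_def cell_def determined_by_def)
  qed
  ultimately show ?thesis by simp
qed

text \<open>The sets with this property contain \<open>\<G>\<close> and survive monotone limits: far enough along the sequence
the limit is \<open>\<delta>/2\<close>-close to a term, which in turn has a \<open>\<delta>/2\<close>-approximation.\<close>

lemma (in finite_measure) approximate_by_finitely_determined:
  assumes G: "\<G> \<subseteq> sets M" and B: "B \<in> sigma_sets (space M) \<G>" and "\<delta> > 0"
  shows "\<exists>G R. finite G \<and> G \<subseteq> \<G> \<and> determined_by (space M) G R \<and>
           measure M (B - R) < \<delta> \<and> measure M (R - B) < \<delta>"
proof -
  let ?A = "{R. \<exists>G. finite G \<and> G \<subseteq> \<G> \<and> determined_by (space M) G R}"
  interpret A: algebra "space M" ?A by (rule algebra_finitely_determined)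
  have A_sets: "?A \<subseteq> sets M"
  proof
    fix R assume "R \<in> ?A"
    then obtain H where "finite H" "H \<subseteq> \<G>" "determined_by (space M) H R" by auto
    with G show "R \<in> sets M" by (intro sets.determined_by_in_sets[of H]) auto
  qed
  have sigma_A: "sigma_sets (space M) ?A \<subseteq> sets M"
    using A_sets by (rule sets.sigma_sets_subset)
  have "B \<in> sigma_sets (space M) ?A"
    using G sets.sets_into_space by (intro sigma_sets_finitely_determined[OF _ B]) auto
  then have "\<forall>\<delta>>0. \<exists>R\<in>?A. measure M (B - R) < \<delta> \<and> measure M (R - B) < \<delta>"
  proof (induction rule: A.monotone_class_induct)
    case (basic A)
    then show ?case by (intro allI impI bexI[of _ A]) auto
  next
    case (inc X)
    show ?case
    proof (intro allI impI)
      fix \<delta> :: real assume "\<delta> > 0"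
      have X: "X i \<in> sets M" for i using inc.hyps(1) sigma_A by auto
      have "(\<lambda>i. measure M (X i)) \<longlonglongrightarrow> measure M (\<Union>i. X i)"
        using X inc.hyps(2) by (intro finite_Lim_measure_incseq) auto
      then obtain i where "dist (measure M (X i)) (measure M (\<Union>i. X i)) < \<delta>/2"
        using metric_LIMSEQ_D[of _ _ "\<delta>/2"] \<open>\<delta> > 0\<close> by fastforce
      then have "measure M (\<Union>i. X i) - measure M (X i) < \<delta>/2"
        unfolding dist_real_def by linarith
      then have i: "measure M ((\<Union>i. X i) - X i) < \<delta>/2"
        using X by (subst finite_measure_Diff) auto
      obtain R where R: "R \<in> ?A" "measure M (X i - R) < \<delta>/2" "measure M (R - X i) < \<delta>/2"
        using inc.IH[of i, rule_format, of "\<delta>/2"] \<open>\<delta> > 0\<close> by auto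
      have R_sets: "R \<in> sets M" using R A_sets by auto
      have "measure M ((\<Union>i. X i) - R) \<le> measure M (((\<Union>i. X i) - X i) \<union> (X i - R))"
        using X R_sets by (intro finite_measure_mono) auto
      also have "\<dots> \<le> measure M ((\<Union>i. X i) - X i) + measure M (X i - R)"
        using X R_sets by (intro measure_Un_le) auto
      finally have "measure M ((\<Union>i. X i) - R) < \<delta>" using i R by simp
      moreover have "measure M (R - (\<Union>i. X i)) \<le> measure M (R - X i)"
        using X R_sets by (intro finite_measure_mono) auto
      ultimately show "\<exists>R\<in>?A. measure M ((\<Union>i. X i) - R) < \<delta> \<and> measure M (R - (\<Union>i. X i)) < \<delta>"
        using R \<open>\<delta> > 0\<close> by (intro bexI[of _ R]) auto
    qed
  next
    case (dec X)
    show ?case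
    proof (intro allI impI)
      fix \<delta> :: real assume "\<delta> > 0"
      have X: "X i \<in> sets M" for i using dec.hyps(1) sigma_A by auto
      have "(\<lambda>i. measure M (X i)) \<longlonglongrightarrow> measure M (\<Inter>i. X i)"
        using X dec.hyps(2) by (intro finite_Lim_measure_decseq) auto
      then obtain i where "dist (measure M (X i)) (measure M (\<Inter>i. X i)) < \<delta>/2"
        using metric_LIMSEQ_D[of _ _ "\<delta>/2"] \<open>\<delta> > 0\<close> by fastforce
      then have "measure M (X i) - measure M (\<Inter>i. X i) < \<delta>/2"
        unfolding dist_real_def by linarith
      then have i: "measure M (X i - (\<Inter>i. X i)) < \<delta>/2"
        using X by (subst finite_measure_Diff) auto
      obtain R where R: "R \<in> ?A" "measure M (X i - R) < \<delta>/2" "measure M (R - X i) < \<delta>/2"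
        using dec.IH[of i, rule_format, of "\<delta>/2"] \<open>\<delta> > 0\<close> by auto
      have R_sets: "R \<in> sets M" using R A_sets by auto
      have "measure M (R - (\<Inter>i. X i)) \<le> measure M ((X i - (\<Inter>i. X i)) \<union> (R - X i))"
        using X R_sets by (intro finite_measure_mono) auto
      also have "\<dots> \<le> measure M (X i - (\<Inter>i. X i)) + measure M (R - X i)"
        using X R_sets by (intro measure_Un_le) auto
      finally have "measure M (R - (\<Inter>i. X i)) < \<delta>" using i R by simp
      moreover have "measure M ((\<Inter>i. X i) - R) \<le> measure M (X i - R)"
        using X R_sets by (intro finite_measure_mono) auto
      ultimately show "\<exists>R\<in>?A. measure M ((\<Inter>i. X i) - R) < \<delta> \<and> measure M (R - (\<Inter>i. X i)) < \<delta>"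
        using R \<open>\<delta> > 0\<close> by (intro bexI[of _ R]) auto
    qed
  qed
  then show ?thesis using \<open>\<delta> > 0\<close> by blast
qed

section \<open>Removal for a family of interacting \<sigma>-algebras\<close>

definition join :: "'x set \<Rightarrow> ('i set \<Rightarrow> 'x set set) \<Rightarrow> 'i set set \<Rightarrow> 'x set set" where
  "join \<Omega> F \<K> = sigma_sets \<Omega> (\<Union>K\<in>\<K>. F K)"

text \<open>\<open>F K\<close> stands for the events that depend only on the coordinates in \<open>K\<close>. The last axiom expresses how
the coordinates interact: an event \<open>W\<close> built from pieces each of which shares at most \<open>j\<close> coordinates
with \<open>I\<close> sees an event \<open>X\<close> on \<open>I\<close> only through the conditional expectation of \<open>X\<close> on events in \<open>j\<close>
coordinates of \<open>I\<close>. For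
\<open>j = 0\<close> this is independence of events without common coordinates.\<close>

locale interacting_algebras = prob_space N for N :: "'x measure" +
  fixes V :: "'i set" and F :: "'i set \<Rightarrow> 'x set set"
  assumes finite_V: "finite V"
    and F_sigma_algebra: "K \<subseteq> V \<Longrightarrow> sigma_algebra (space N) (F K)"
    and F_sets: "K \<subseteq> V \<Longrightarrow> F K \<subseteq> sets N"
    and F_mono: "K \<subseteq> K' \<Longrightarrow> K' \<subseteq> V \<Longrightarrow> F K \<subseteq> F K'"
    and F_empty: "F {} \<subseteq> {{}, space N}"
    and orthogonal: "I \<subseteq> V \<Longrightarrow> X \<in> F I \<Longrightarrow>
      W \<in> join (space N) F {K. K \<subseteq> V \<and> card (K \<inter> I) \<le> j} \<Longrightarrow>
      measure N (X \<inter> W) =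
        (\<integral>x. real_cond_exp N (sigma (space N) (\<Union>K\<in>{K. K \<subseteq> I \<and> card K \<le> j}. F K))
               (indicator X) x * indicator W x \<partial>N)"
begin

abbreviation lower :: "nat \<Rightarrow> 'i set \<Rightarrow> 'x set set" where
  "lower j I \<equiv> join (space N) F {K. K \<subseteq> I \<and> card K \<le> j}"

abbreviation transverse :: "nat \<Rightarrow> 'i set \<Rightarrow> 'x set set" where
  "transverse j I \<equiv> join (space N) F {K. K \<subseteq> V \<and> card (K \<inter> I) \<le> j}"

lemma gens_subset: "\<K> \<subseteq> Pow V \<Longrightarrow> (\<Union>K\<in>\<K>. F K) \<subseteq> sets N"
  using F_sets by blast

lemma sigma_algebra_join: "\<K> \<subseteq> Pow V \<Longrightarrow> sigma_algebra (space N) (join (space N) F \<K>)"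
  unfolding join_def
  by (rule sigma_algebra_sigma_sets[OF order_trans[OF gens_subset sets.space_closed]])

lemma join_sets: "\<K> \<subseteq> Pow V \<Longrightarrow> join (space N) F \<K> \<subseteq> sets N"
  unfolding join_def by (rule sets.sigma_sets_subset[OF gens_subset])

lemma F_subset_join: "K \<in> \<K> \<Longrightarrow> F K \<subseteq> join (space N) F \<K>"
  unfolding join_def by auto

lemma join_least:
  assumes "sigma_algebra (space N) \<A>" "\<And>K. K \<in> \<K> \<Longrightarrow> F K \<subseteq> \<A>"
  shows "join (space N) F \<K> \<subseteq> \<A>"
  unfolding join_def by (rule sigma_algebra.sigma_sets_subset[OF assms(1)]) (use assms(2) in auto)

lemma sigma_algebra_lower: "I \<subseteq> V \<Longrightarrow> sigma_algebra (space N) (lower j I)"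
  by (rule sigma_algebra_join) auto

lemma sigma_algebra_transverse: "sigma_algebra (space N) (transverse j I)"
  by (rule sigma_algebra_join) auto

lemma lower_subset_F: "I \<subseteq> V \<Longrightarrow> lower j I \<subseteq> F I"
  by (rule join_least[OF F_sigma_algebra]) (use F_mono in auto)

lemma F_subset_lower: "K \<subseteq> I \<Longrightarrow> card K \<le> j \<Longrightarrow> F K \<subseteq> lower j I"
  by (rule F_subset_join) auto

lemma F_subset_transverse: "K \<subseteq> V \<Longrightarrow> card (K \<inter> I) \<le> j \<Longrightarrow> F K \<subseteq> transverse j I"
  by (rule F_subset_join) auto

lemma lower_subset_transverse:
  assumes "I' \<subseteq> V" shows "lower j I' \<subseteq> transverse j I"
proof (rule join_least[OF sigma_algebra_transverse])
  fix K assume K: "K \<in> {K. K \<subseteq> I' \<and> card K \<le> j}"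
  then have "finite K" using assms finite_V by (auto intro: finite_subset)
  then have "card (K \<inter> I) \<le> j" using K card_mono[of K "K \<inter> I"] by auto
  then show "F K \<subseteq> transverse j I" using K assms by (intro F_subset_transverse) auto
qed

lemma transverse_sets: "transverse j I \<subseteq> sets N"
  by (rule join_sets) auto

lemma sets_sigma_lower:
  assumes "I \<subseteq> V" shows "sets (sigma (space N) (lower j I)) = lower j I"
proof -
  have "lower j I \<subseteq> sets N" using assms by (intro join_sets) auto
  then have "lower j I \<subseteq> Pow (space N)" using sets.space_closed by (rule order_trans)
  then show ?thesis
    using sigma_algebra.sigma_sets_eq[OF sigma_algebra_lower[OF assms]] by simp
qed

lemma conditional_expectation_lower:
  assumes "I \<subseteq> V" "X \<in> F I"
  shows "\<exists>g :: 'x \<Rightarrow> real. g \<in> borel_measurable (sigma (space N) (lower j I)) \<and> integrable N g \<and>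
    (\<forall>W \<in> transverse j I. measure N (X \<inter> W) = (\<integral>x. g x * indicator W x \<partial>N))"
proof -
  let ?G = "\<Union>K\<in>{K. K \<subseteq> I \<and> card K \<le> j}. F K"
  let ?L = "sigma (space N) ?G"
  have G: "?G \<subseteq> sets N" using assms by (intro gens_subset) auto
  then have G': "?G \<subseteq> Pow (space N)" using sets.space_closed by blast
  have sets_L: "sets ?L = lower j I" unfolding join_def using G' by simp
  have "subalgebra N ?L"
    unfolding subalgebra_def using G' G sets.sigma_sets_subset[OF G] by simp
  then interpret finite_measure_subalgebra N ?L by unfold_locales
  have "X \<in> sets N" using assms F_sets by auto
  then have int: "integrable N (indicator X :: 'x \<Rightarrow> real)"
    by (intro integrable_real_indicator) (auto simp: less_top[symmetric])
  have L_eq: "sets (sigma (space N) (lower j I)) = sets ?L"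
    using sets_sigma_lower[OF assms(1)] sets_L by simp
  show ?thesis
  proof (intro exI conjI ballI)
    have "real_cond_exp N ?L (indicator X) \<in> borel_measurable ?L" by simp
    then show "real_cond_exp N ?L (indicator X) \<in> borel_measurable (sigma (space N) (lower j I))"
      using L_eq measurable_cong_sets by blast
    show "integrable N (real_cond_exp N ?L (indicator X))" using int by (rule real_cond_exp_int)
    show "measure N (X \<inter> W) = (\<integral>x. real_cond_exp N ?L (indicator X) x * indicator W x \<partial>N)"
      if "W \<in> transverse j I" for W
      using that assms by (intro orthogonal)
  qed
qed

text \<open>\<open>Q\<close> is the set where the density of \<open>X\<close> on level \<open>j\<close> is at most \<open>\<epsilon>\<close> times that of \<open>C\<close>. It is used with
\<open>X = C - A\<close>: then \<open>A\<close> fills all but a fraction \<open>\<epsilon>\<close> of \<open>C\<close> on \<open>Q\<close>, and keeps doing so when \<open>C\<close> is cut down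
by any transverse event \<open>W\<close>; off \<open>Q\<close>, \<open>C\<close> is at most \<open>1/\<epsilon>\<close> times as large as \<open>C - A\<close>. Integrating the two
densities over transverse sets gives both estimates.\<close>

lemma density_level:
  assumes "I \<subseteq> V" "X \<in> F I" "C \<in> F I" "\<epsilon> > 0"
  obtains Q where "Q \<in> lower j I"
    "\<And>W. W \<in> transverse j I \<Longrightarrow> W \<subseteq> Q \<Longrightarrow> measure N (X \<inter> W) \<le> \<epsilon> * measure N (C \<inter> W)"
    "\<epsilon> * measure N (C - Q) \<le> measure N (X - Q)"
proof -
  obtain g where g: "g \<in> borel_measurable (sigma (space N) (lower j I))" "integrable N g"
    "\<And>W. W \<in> transverse j I \<Longrightarrow> measure N (X \<inter> W) = (\<integral>x. g x * indicator W x \<partial>N)"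
    using conditional_expectation_lower[OF assms(1,2), of j] by blast
  obtain h where h: "h \<in> borel_measurable (sigma (space N) (lower j I))" "integrable N h"
    "\<And>W. W \<in> transverse j I \<Longrightarrow> measure N (C \<inter> W) = (\<integral>x. h x * indicator W x \<partial>N)"
    using conditional_expectation_lower[OF assms(1,3), of j] by blast
  define Q where "Q = {x \<in> space N. g x \<le> \<epsilon> * h x}"
  interpret L: sigma_algebra "space N" "lower j I" by (rule sigma_algebra_lower[OF assms(1)])
  interpret T: sigma_algebra "space N" "transverse j I" by (rule sigma_algebra_transverse)
  have "{x \<in> space (sigma (space N) (lower j I)). g x \<le> \<epsilon> * h x} \<in> sets (sigma (space N) (lower j I))"
    using g(1) h(1) by measurable
  then have Q: "Q \<in> lower j I" by (simp add: sets_sigma_lower[OF assms(1)] Q_def)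
  then have QT: "Q \<in> transverse j I" using lower_subset_transverse[OF assms(1)] by blast
  have int: "integrable N (\<lambda>x. g x * indicator W x)" "integrable N (\<lambda>x. \<epsilon> * (h x * indicator W x))"
    if "W \<in> transverse j I" for W
    using that g(2) h(2) transverse_sets by (auto intro!: integrable_real_mult_indicator)
  show ?thesis
  proof (rule that[OF Q])
    fix W assume W: "W \<in> transverse j I" "W \<subseteq> Q"
    have "measure N (X \<inter> W) = (\<integral>x. g x * indicator W x \<partial>N)" using W by (intro g)
    also have "\<dots> \<le> (\<integral>x. \<epsilon> * (h x * indicator W x) \<partial>N)"
      using W by (intro integral_mono int) (auto simp: Q_def indicator_def)
    also have "\<dots> = \<epsilon> * measure N (C \<inter> W)" using W h by simp
    finally show "measure N (X \<inter> W) \<le> \<epsilon> * measure N (C \<inter> W)" .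
  next
    let ?W = "space N - Q"
    have W: "?W \<in> transverse j I" using QT by auto
    have spaces: "X \<subseteq> space N" "C \<subseteq> space N"
      using assms F_sets[OF assms(1)] sets.sets_into_space by blast+
    have "\<epsilon> * measure N (C \<inter> ?W) = (\<integral>x. \<epsilon> * (h x * indicator ?W x) \<partial>N)" using W h by simp
    also have "\<dots> \<le> (\<integral>x. g x * indicator ?W x \<partial>N)"
      using W by (intro integral_mono int) (auto simp: Q_def indicator_def)
    also have "\<dots> = measure N (X \<inter> ?W)" using W by (intro g(3)[symmetric])
    finally have "\<epsilon> * measure N (C \<inter> ?W) \<le> measure N (X \<inter> ?W)" .
    moreover have "C \<inter> ?W = C - Q" "X \<inter> ?W = X - Q" using spaces by auto
    ultimately show "\<epsilon> * measure N (C - Q) \<le> measure N (X - Q)" by simp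
  qed
qed

text \<open>\<open>P\<close> is the set where the conditional expectation of \<open>C\<close> is positive. Passing from \<open>C\<close> to \<open>P\<close> lowers the
complexity of an event without losing a non-null part of \<open>C\<close> and without making a null transverse
intersection non-null.\<close>

lemma support_level:
  assumes "K \<subseteq> V" "C \<in> F K"
  obtains P where "P \<in> lower j K" "measure N (C - P) = 0"
    "\<And>W. W \<in> transverse j K \<Longrightarrow> measure N (C \<inter> W) = 0 \<Longrightarrow> measure N (P \<inter> W) = 0"
proof -
  obtain g where g: "g \<in> borel_measurable (sigma (space N) (lower j K))" "integrable N g"
    "\<And>W. W \<in> transverse j K \<Longrightarrow> measure N (C \<inter> W) = (\<integral>x. g x * indicator W x \<partial>N)"
    using conditional_expectation_lower[OF assms(1,2), of j] by blast
  define P where "P = {x \<in> space N. 0 < g x}"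
  interpret L: sigma_algebra "space N" "lower j K" by (rule sigma_algebra_lower[OF assms(1)])
  interpret T: sigma_algebra "space N" "transverse j K" by (rule sigma_algebra_transverse)
  have "{x \<in> space (sigma (space N) (lower j K)). 0 < g x} \<in> sets (sigma (space N) (lower j K))"
    using g(1) by measurable
  then have P: "P \<in> lower j K" by (simp add: sets_sigma_lower[OF assms(1)] P_def)
  then have PT: "P \<in> transverse j K" using lower_subset_transverse[OF assms(1)] by blast
  have int: "integrable N (\<lambda>x. g x * indicator W x)" if "W \<in> transverse j K" for W
    using that g(2) transverse_sets by (auto intro!: integrable_real_mult_indicator)
  show ?thesis
  proof (rule that[OF P])
    let ?W = "space N - P"
    have W: "?W \<in> transverse j K" using PT by auto
    have C_space: "C \<subseteq> space N"
      using assms F_sets[OF assms(1)] sets.sets_into_space by blast+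
    have "measure N (C \<inter> ?W) = (\<integral>x. g x * indicator ?W x \<partial>N)" using W by (intro g)
    also have "\<dots> \<le> (\<integral>x. 0 \<partial>N)"
      using W by (intro integral_mono int) (auto simp: P_def indicator_def)
    finally have "measure N (C \<inter> ?W) \<le> 0" by simp
    moreover have "C \<inter> ?W = C - P" using C_space by auto
    ultimately show "measure N (C - P) = 0" by (simp add: measure_le_0_iff)
  next
    fix W assume W: "W \<in> transverse j K" "measure N (C \<inter> W) = 0"
    have PW: "P \<inter> W \<in> transverse j K" using W PT by auto
    have PWN: "P \<inter> W \<in> sets N" using PW transverse_sets by auto
    have "measure N (C \<inter> (P \<inter> W)) \<le> measure N (C \<inter> W)"
      using subsetD[OF transverse_sets W(1)] subsetD[OF F_sets[OF assms(1)] assms(2)]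
      by (intro finite_measure_mono) auto
    then have "(\<integral>x. g x * indicator (P \<inter> W) x \<partial>N) = 0"
      using W g(3)[OF PW] measure_nonneg[of N "C \<inter> (P \<inter> W)"] by simp
    moreover have "AE x in N. 0 \<le> g x * indicator (P \<inter> W) x"
      by (auto simp: P_def indicator_def)
    ultimately have "AE x in N. g x * indicator (P \<inter> W) x = 0"
      using integral_nonneg_eq_0_iff_AE[OF int[OF PW]] by simp
    then have "AE x in N. x \<notin> P \<inter> W"
      by eventually_elim (auto simp: P_def indicator_def)
    then show "measure N (P \<inter> W) = 0"
      using PWN by (simp add: AE_iff_measurable[OF _ refl] prob_eq_0)
  qed
qed

end

text \<open>In the application \<open>\<mu> X\<close> is the measure of a projection of the part of \<open>X\<close> in a set that may be null for
\<open>N\<close>; projections of disjoint sets may overlap, whence only subadditivity. The domination by \<open>N\<close> is required on each \<open>F I\<close> separately; on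
events that mix several \<open>I\<close> there is none.\<close>

locale controlled_submeasure = interacting_algebras N V F
  for N :: "'x measure" and V :: "'i set" and F +
  fixes \<J> :: "'i set set" and \<mu> :: "'x set \<Rightarrow> real" and k :: real
  assumes \<J>_subset: "\<J> \<subseteq> Pow V" and \<J>_nonempty: "\<J> \<noteq> {}"
    and \<mu>_mono: "A \<in> sets N \<Longrightarrow> B \<in> sets N \<Longrightarrow> A \<subseteq> B \<Longrightarrow> \<mu> A \<le> \<mu> B"
    and \<mu>_Un: "A \<in> sets N \<Longrightarrow> B \<in> sets N \<Longrightarrow> \<mu> (A \<union> B) \<le> \<mu> A + \<mu> B"
    and \<mu>_le: "I \<in> \<J> \<Longrightarrow> A \<in> F I \<Longrightarrow> \<mu> A \<le> k * measure N A"
    and k_pos: "k > 0"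
begin

lemma finite_\<J>: "finite \<J>"
  using \<J>_subset finite_V by (meson finite_Pow_iff finite_subset)

lemma \<J>_V: "I \<in> \<J> \<Longrightarrow> I \<subseteq> V"
  using \<J>_subset by auto

lemma \<mu>_empty: "\<mu> {} \<le> 0"
proof -
  obtain I where I: "I \<in> \<J>" using \<J>_nonempty by auto
  interpret sigma_algebra "space N" "F I" by (rule F_sigma_algebra[OF \<J>_V[OF I]])
  show ?thesis using \<mu>_le[OF I, of "{}"] by simp
qed

lemma \<mu>_UN:
  assumes "finite T" "\<And>t. t \<in> T \<Longrightarrow> X t \<in> sets N"
  shows "\<mu> (\<Union>t\<in>T. X t) \<le> (\<Sum>t\<in>T. \<mu> (X t))"
  using assms
proof (induction T rule: finite_induct)
  case empty
  then show ?case using \<mu>_empty by simp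
next
  case (insert t T)
  then have "\<mu> (X t \<union> (\<Union>t\<in>T. X t)) \<le> \<mu> (X t) + \<mu> (\<Union>t\<in>T. X t)"
    by (intro \<mu>_Un) auto
  moreover have "\<mu> (\<Union>t\<in>T. X t) \<le> (\<Sum>t\<in>T. \<mu> (X t))" using insert by auto
  ultimately show ?case using insert(1,2) by simp
qed

text \<open>A cell is an intersection of events \<open>C K\<close> in at most \<open>j + 1\<close> coordinates; \<open>D I\<close> collects those of its
  sides that lie in \<open>I\<close>. If each \<open>A I\<close> nearly fills \<open>D I\<close> on \<open>Q I\<close>, robustly under transverse
  intersections, then each nearly fills the whole cell \<open>Z\<close>, because the sides not in \<open>I\<close> are transverse
  to \<open>I\<close>. The missing fractions add up to less than one, so a null intersection of the
  \<open>A I\<close> forces \<open>Z\<close> to be null. Replacing the sides of \<open>Z\<close> by their supports, one at a time, keeps the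
  intersection null (each side is transverse to the other ones) and lands in level \<open>j\<close>, where the
  induction hypothesis applies.\<close>

lemma cell_null:
  fixes C :: "'i set \<Rightarrow> 'x set" and A Q :: "'i set \<Rightarrow> 'x set" and j :: nat and \<epsilon> :: real
  defines "\<K> \<equiv> {K. card K \<le> Suc j \<and> (\<exists>I\<in>\<J>. K \<subseteq> I)}"
  defines "D \<equiv> \<lambda>I. \<Inter>K\<in>{K\<in>\<K>. K \<subseteq> I}. C K"
  assumes descent: "\<And>A. (\<And>I. I \<in> \<J> \<Longrightarrow> A I \<in> lower j I) \<Longrightarrow> measure N (\<Inter>I\<in>\<J>. A I) = 0 \<Longrightarrow>
      \<mu> (\<Inter>I\<in>\<J>. A I) \<le> 0"
    and C: "\<And>K. K \<in> \<K> \<Longrightarrow> C K \<in> F K"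
    and Q: "\<And>I. I \<in> \<J> \<Longrightarrow> Q I \<in> lower j I"
    and A: "\<And>I. I \<in> \<J> \<Longrightarrow> A I \<in> F I"
    and null: "measure N (\<Inter>I\<in>\<J>. A I) = 0"
    and \<epsilon>: "\<epsilon> * card \<J> < 1"
    and dense: "\<And>I W. I \<in> \<J> \<Longrightarrow> W \<in> transverse j I \<Longrightarrow> W \<subseteq> Q I \<Longrightarrow>
      measure N ((D I - A I) \<inter> W) \<le> \<epsilon> * measure N (D I \<inter> W)"
  shows "\<mu> ((\<Inter>K\<in>\<K>. C K) \<inter> (\<Inter>I\<in>\<J>. Q I)) \<le> 0"
proof -
  obtain I0 where I0: "I0 \<in> \<J>" using \<J>_nonempty by auto
  have \<K>_V: "K \<subseteq> V" if "K \<in> \<K>" for K using that \<J>_V by (auto simp: \<K>_def)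
  have "\<K> \<subseteq> Pow V" using \<K>_V by auto
  then have fin_\<K>: "finite \<K>" using finite_V by (meson finite_Pow_iff finite_subset)
  have empty_\<K>: "{} \<in> \<K>" using I0 by (auto simp: \<K>_def)
  have CN: "C K \<in> sets N" if "K \<in> \<K>" for K using C[OF that] F_sets[OF \<K>_V[OF that]] by auto
  have lower_N: "X \<in> sets N" if "X \<in> lower j I" "I \<in> \<J>" for X I
    using that lower_subset_F[of I j] F_sets[of I] \<J>_V by blast
  have QN: "Q I \<in> sets N" if "I \<in> \<J>" for I using lower_N Q that by auto
  have AN: "A I \<in> sets N" if "I \<in> \<J>" for I using A F_sets[OF \<J>_V] that by auto
  let ?Q = "\<Inter>I\<in>\<J>. Q I"
  define Z where "Z = (\<Inter>K\<in>\<K>. C K) \<inter> ?Q"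
  have Q_N: "?Q \<in> sets N" using QN finite_\<J> \<J>_nonempty by (intro sets.finite_INT) auto
  have Q_T: "?Q \<in> transverse j I" for I
  proof -
    interpret T: sigma_algebra "space N" "transverse j I" by (rule sigma_algebra_transverse)
    show ?thesis
      using Q lower_subset_transverse[OF \<J>_V] finite_\<J> \<J>_nonempty by (intro T.finite_INT) blast+
  qed
  have C_N: "(\<Inter>K\<in>\<K>. C K) \<in> sets N" using CN fin_\<K> empty_\<K> by (intro sets.finite_INT) auto
  have ZN: "Z \<in> sets N" unfolding Z_def using C_N Q_N by auto
  have Z_A: "measure N (Z - A I) \<le> \<epsilon> * measure N Z" if I: "I \<in> \<J>" for I
  proof -
    interpret T: sigma_algebra "space N" "transverse j I" by (rule sigma_algebra_transverse)
    (* The index {} carries the part coming from Q, so that W is a single finite intersection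
       even if every side lies in I; the side indexed by {} lies in I anyway. *)
    define W where "W = (\<Inter>K\<in>insert {} {K\<in>\<K>. \<not> K \<subseteq> I}. if K = {} then ?Q else C K)"
    have "C K \<in> transverse j I" if "K \<in> \<K>" "\<not> K \<subseteq> I" for K
    proof -
      have "finite K" using \<K>_V[OF that(1)] finite_V by (rule finite_subset)
      moreover have "K \<inter> I \<subset> K" using that by auto
      ultimately have "card (K \<inter> I) < card K" by (rule psubset_card_mono)
      also have "card K \<le> Suc j" using that by (auto simp: \<K>_def)
      finally have "F K \<subseteq> transverse j I" using that \<K>_V by (intro F_subset_transverse) auto
      then show ?thesis using C that by auto
    qed
    then have W: "W \<in> transverse j I"
      unfolding W_def using Q_T fin_\<K> by (intro T.finite_INT) auto
    have "Z = D I \<inter> W"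
    proof (intro set_eqI iffI)
      fix x assume "x \<in> Z"
      then show "x \<in> D I \<inter> W" by (auto simp: Z_def D_def W_def)
    next
      fix x assume x: "x \<in> D I \<inter> W"
      then have "x \<in> ?Q" by (auto simp: W_def)
      moreover have "x \<in> C K" if "K \<in> \<K>" for K
        using x that by (cases "K \<subseteq> I") (force simp: D_def W_def)+
      ultimately show "x \<in> Z" by (auto simp: Z_def)
    qed
    moreover have "W \<subseteq> Q I" using I by (auto simp: W_def)
    ultimately show ?thesis using dense[OF I W] by (simp add: Int_Diff Int_commute Diff_Int_distrib2)
  qed
  have "measure N Z \<le> measure N ((\<Inter>I\<in>\<J>. A I) \<union> (\<Union>I\<in>\<J>. Z - A I))"
    using ZN AN finite_\<J> \<J>_nonempty
    by (intro finite_measure_mono sets.Un sets.finite_INT sets.finite_UN sets.Diff) auto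
  also have "\<dots> \<le> measure N (\<Inter>I\<in>\<J>. A I) + measure N (\<Union>I\<in>\<J>. Z - A I)"
    using ZN AN finite_\<J> \<J>_nonempty
    by (intro measure_Un_le sets.finite_INT sets.finite_UN sets.Diff) auto
  also have "measure N (\<Union>I\<in>\<J>. Z - A I) \<le> (\<Sum>I\<in>\<J>. measure N (Z - A I))"
    using ZN AN finite_\<J> by (intro measure_UNION_le) auto
  also have "\<dots> \<le> (\<Sum>I\<in>\<J>. \<epsilon> * measure N Z)" by (intro sum_mono Z_A)
  finally have "measure N Z \<le> (\<epsilon> * card \<J>) * measure N Z" using null by (simp add: mult_ac)
  then have "measure N Z * (1 - \<epsilon> * card \<J>) \<le> 0" by (simp add: algebra_simps)
  then have Z_null: "measure N Z = 0"
    using \<epsilon> by (simp add: mult_le_0_iff measure_le_0_iff)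

  have "\<forall>K\<in>\<K>. \<exists>P. P \<in> lower j K \<and> measure N (C K - P) = 0 \<and>
      (\<forall>W \<in> transverse j K. measure N (C K \<inter> W) = 0 \<longrightarrow> measure N (P \<inter> W) = 0)"
  proof
    fix K assume K: "K \<in> \<K>"
    show "\<exists>P. P \<in> lower j K \<and> measure N (C K - P) = 0 \<and>
      (\<forall>W \<in> transverse j K. measure N (C K \<inter> W) = 0 \<longrightarrow> measure N (P \<inter> W) = 0)"
      by (rule support_level[OF \<K>_V[OF K] C[OF K], of j]) blast
  qed
  from bchoice[OF this] obtain P0 where P0: "\<And>K. K \<in> \<K> \<Longrightarrow> P0 K \<in> lower j K"
    "\<And>K. K \<in> \<K> \<Longrightarrow> measure N (C K - P0 K) = 0"
    "\<And>K W. K \<in> \<K> \<Longrightarrow> W \<in> transverse j K \<Longrightarrow> measure N (C K \<inter> W) = 0 \<Longrightarrow> measure N (P0 K \<inter> W) = 0"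
    by blast
  (* Sides in at most j coordinates are on the right level already and must not be replaced:
     they need not be transverse to the sides that contain them. *)
  define P where "P K = (if card K \<le> j then C K else P0 K)" for K
  have P: "P K \<in> lower j K" if "K \<in> \<K>" for K
    using P0(1)[OF that] C[OF that] F_subset_lower[of K K j] by (auto simp: P_def)
  have P_null: "measure N (C K - P K) = 0" if "K \<in> \<K>" for K
    using P0(2)[OF that] by (simp add: P_def)
  have PN: "P K \<in> sets N" if "K \<in> \<K>" for K
    using P[OF that] lower_subset_F[OF \<K>_V[OF that], of j] F_sets[OF \<K>_V[OF that]] by blast

  define mixed where "mixed T = (\<Inter>K\<in>\<K>. if K \<in> T then P K else C K) \<inter> ?Q" for T
  have mixed_null: "measure N (mixed T) = 0" if "T \<subseteq> \<K>" for T
    using finite_subset[OF that fin_\<K>] that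
  proof (induction T rule: finite_subset_induct')
    case empty
    then show ?case using Z_null by (simp add: mixed_def Z_def)
  next
    case (insert K T)
    show ?case
    proof (cases "card K \<le> j")
      case True
      then have "mixed (insert K T) = mixed T" by (auto simp: mixed_def P_def split: if_splits)
      then show ?thesis using insert by simp
    next
      case False
      interpret T: sigma_algebra "space N" "transverse j K" by (rule sigma_algebra_transverse)
      define W where "W = (\<Inter>K'\<in>insert K \<K>. if K' = K then ?Q else if K' \<in> T then P K' else C K')"
      have card_K: "card K = Suc j" using False insert by (auto simp: \<K>_def)
      have "(if K' \<in> T then P K' else C K') \<in> transverse j K" if K': "K' \<in> \<K>" "K' \<noteq> K" for K'
      proof -
        have fin: "finite K'" "finite K"
          using \<K>_V[OF K'(1)] \<K>_V[OF insert(2)] finite_V by (simp_all add: finite_subset)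
        have "K' \<inter> K \<subset> K"
        proof (rule ccontr)
          assume "\<not> K' \<inter> K \<subset> K"
          then have "K \<subseteq> K'" by auto
          moreover have "card K' \<le> card K" using K' card_K by (auto simp: \<K>_def)
          ultimately show False using K'(2) fin card_seteq by metis
        qed
        then have "card (K' \<inter> K) < card K" using fin by (intro psubset_card_mono) auto
        then have "F K' \<subseteq> transverse j K" using card_K K' \<K>_V by (intro F_subset_transverse) auto
        moreover have "P K' \<in> transverse j K"
          using P[OF K'(1)] lower_subset_transverse[OF \<K>_V[OF K'(1)]] by blast
        ultimately show ?thesis using C K' by auto
      qed
      then have "(if K' = K then ?Q else if K' \<in> T then P K' else C K') \<in> transverse j K"
        if "K' \<in> insert K \<K>" for K'
        using that Q_T by (cases "K' = K") auto
      then have W: "W \<in> transverse j K"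
        unfolding W_def using fin_\<K> by (intro T.finite_INT) auto
      have "mixed T = C K \<inter> W" "mixed (insert K T) = P K \<inter> W"
        using insert by (auto simp: mixed_def W_def split: if_splits)
      moreover have "P K = P0 K" using False by (simp add: P_def)
      ultimately show ?thesis using P0(3)[OF _ W] insert by auto
    qed
  qed

  define A' where "A' I = Q I \<inter> (\<Inter>K\<in>{K\<in>\<K>. K \<subseteq> I}. P K)" for I
  have A'_lower: "A' I \<in> lower j I" if I: "I \<in> \<J>" for I
  proof -
    interpret L: sigma_algebra "space N" "lower j I" by (rule sigma_algebra_lower[OF \<J>_V[OF I]])
    have "lower j K \<subseteq> lower j I" if "K \<subseteq> I" for K
      using that by (intro join_least[OF L.sigma_algebra_axioms] F_subset_lower) auto
    then have "P K \<in> lower j I" if "K \<in> \<K>" "K \<subseteq> I" for K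
      using P that by blast
    then show ?thesis
      unfolding A'_def using Q[OF I] fin_\<K> empty_\<K> by (intro L.Int L.finite_INT) auto
  qed
  have A'_eq: "(\<Inter>I\<in>\<J>. A' I) = mixed \<K>"
    unfolding A'_def mixed_def \<K>_def by auto
  have "\<mu> (\<Inter>I\<in>\<J>. A' I) \<le> 0"
    using mixed_null[of \<K>] A'_eq by (intro descent A'_lower) auto
  moreover have "(\<Inter>I\<in>\<J>. A' I) \<in> sets N"
    using A'_lower lower_N finite_\<J> \<J>_nonempty by (intro sets.finite_INT) auto
  moreover have "\<mu> (C K - P K) \<le> 0" if K: "K \<in> \<K>" for K
  proof -
    obtain I where I: "I \<in> \<J>" "K \<subseteq> I" using K by (auto simp: \<K>_def)
    interpret FK: sigma_algebra "space N" "F K" by (rule F_sigma_algebra[OF \<K>_V[OF K]])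
    have "C K - P K \<in> F K" using C[OF K] P[OF K] lower_subset_F[OF \<K>_V[OF K]] by blast
    then have "C K - P K \<in> F I" using F_mono[OF I(2) \<J>_V[OF I(1)]] by auto
    then show ?thesis using \<mu>_le[OF I(1)] P_null[OF K] by fastforce
  qed
  then have "\<mu> (\<Union>K\<in>\<K>. C K - P K) \<le> 0"
    using \<mu>_UN[OF fin_\<K>, of "\<lambda>K. C K - P K"] CN PN sum_nonpos[of \<K> "\<lambda>K. \<mu> (C K - P K)"] by fastforce
  moreover have UN_N: "(\<Union>K\<in>\<K>. C K - P K) \<in> sets N" using CN PN fin_\<K> by auto
  moreover have "Z \<subseteq> (\<Inter>I\<in>\<J>. A' I) \<union> (\<Union>K\<in>\<K>. C K - P K)"
    unfolding A'_eq by (auto simp: Z_def mixed_def)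
  ultimately have "\<mu> Z \<le> 0"
    using \<mu>_mono[OF ZN, of "(\<Inter>I\<in>\<J>. A' I) \<union> (\<Union>K\<in>\<K>. C K - P K)"]
      \<mu>_Un[of "\<Inter>I\<in>\<J>. A' I" "\<Union>K\<in>\<K>. C K - P K"] by auto
  then show ?thesis by (simp add: Z_def)
qed

text \<open>Approximate each \<open>A I\<close> by a union \<open>R I\<close> of cells of one finite partition. The part of \<open>A I\<close> outside
\<open>R I\<close>, and the part in cells of \<open>R I\<close> where \<open>A I\<close> is not dense on level \<open>j\<close>, form a set \<open>Y I\<close> of small
\<open>N\<close>-measure in \<open>F I\<close>, hence of small \<open>\<mu>\<close>-measure. Up to these, the intersection of the \<open>A I\<close> is covered by
finitely many cells in which every \<open>A I\<close> is dense, and those are \<open>\<mu>\<close>-null by \<open>cell_null\<close>.\<close>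

lemma descent_step:
  fixes A :: "'i set \<Rightarrow> 'x set" and j :: nat
  assumes descent: "\<And>A. (\<And>I. I \<in> \<J> \<Longrightarrow> A I \<in> lower j I) \<Longrightarrow> measure N (\<Inter>I\<in>\<J>. A I) = 0 \<Longrightarrow>
      \<mu> (\<Inter>I\<in>\<J>. A I) \<le> 0"
    and A: "\<And>I. I \<in> \<J> \<Longrightarrow> A I \<in> lower (Suc j) I"
    and null: "measure N (\<Inter>I\<in>\<J>. A I) = 0"
  shows "\<mu> (\<Inter>I\<in>\<J>. A I) \<le> 0"
proof (rule field_le_epsilon)
  fix \<eta> :: real assume "\<eta> > 0"
  (* With less than 1 / card J lost for each I, something common to all of them remains. *)
  define \<epsilon> :: real where "\<epsilon> = 1 / (card \<J> + 1)"
  (* Chosen so that k times the bound on the measure of Y I, summed over I, equals \<eta>. *)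
  define \<delta> where "\<delta> = \<eta> / (card \<J> * k * (1 + 1 / \<epsilon>))"
  define gens where "gens I = (\<Union>K\<in>{K. K \<subseteq> I \<and> card K \<le> Suc j}. F K)" for I
  define \<K> where "\<K> = {K. card K \<le> Suc j \<and> (\<exists>I\<in>\<J>. K \<subseteq> I)}"
  have card_pos: "card \<J> > 0" using finite_\<J> \<J>_nonempty by (simp add: card_gt_0_iff)
  have \<epsilon>: "\<epsilon> > 0" "\<epsilon> * card \<J> < 1" by (auto simp: \<epsilon>_def field_simps)
  have \<delta>: "\<delta> > 0" using \<open>\<eta> > 0\<close> card_pos k_pos \<epsilon> by (auto simp: \<delta>_def add_pos_pos)
  have \<K>_V: "K \<subseteq> V" if "K \<in> \<K>" for K using that \<J>_V by (auto simp: \<K>_def)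
  have "\<K> \<subseteq> Pow V" using \<K>_V by auto
  then have fin_\<K>: "finite \<K>" using finite_V by (meson finite_Pow_iff finite_subset)
  have AF: "A I \<in> F I" if "I \<in> \<J>" for I
    using A[OF that] lower_subset_F[OF \<J>_V[OF that]] by blast
  have AN: "A I \<in> sets N" if "I \<in> \<J>" for I using AF F_sets[OF \<J>_V] that by auto
  have F_N: "X \<in> sets N" if "X \<in> F I" "I \<in> \<J>" for X I
    using that F_sets[OF \<J>_V] by auto

  have "\<forall>I\<in>\<J>. \<exists>p. finite (fst p) \<and> fst p \<subseteq> gens I \<and> determined_by (space N) (fst p) (snd p) \<and>
      measure N (A I - snd p) < \<delta> \<and> measure N (snd p - A I) < \<delta>"
  proof
    fix I assume I: "I \<in> \<J>"
    have "gens I \<subseteq> sets N" unfolding gens_def using \<J>_V[OF I] by (intro gens_subset) auto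
    moreover have "A I \<in> sigma_sets (space N) (gens I)"
      using A[OF I] by (simp add: join_def gens_def)
    ultimately have "\<exists>G R. finite G \<and> G \<subseteq> gens I \<and> determined_by (space N) G R \<and>
      measure N (A I - R) < \<delta> \<and> measure N (R - A I) < \<delta>"
      using \<delta> by (rule approximate_by_finitely_determined)
    then show "\<exists>p. finite (fst p) \<and> fst p \<subseteq> gens I \<and> determined_by (space N) (fst p) (snd p) \<and>
      measure N (A I - snd p) < \<delta> \<and> measure N (snd p - A I) < \<delta>" by simp
  qed
  from bchoice[OF this] obtain p where p: "\<forall>I\<in>\<J>. finite (fst (p I)) \<and> fst (p I) \<subseteq> gens I \<and>
      determined_by (space N) (fst (p I)) (snd (p I)) \<and>
      measure N (A I - snd (p I)) < \<delta> \<and> measure N (snd (p I) - A I) < \<delta>" by blast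
  define G where "G I = fst (p I)" for I
  define R where "R I = snd (p I)" for I
  have G: "finite (G I)" "G I \<subseteq> gens I" "determined_by (space N) (G I) (R I)"
    "measure N (A I - R I) < \<delta>" "measure N (R I - A I) < \<delta>" if "I \<in> \<J>" for I
    using p that by (auto simp: G_def R_def)
  have RN: "R I \<in> sets N" if I: "I \<in> \<J>" for I
  proof -
    have "gens I \<subseteq> sets N" unfolding gens_def using \<J>_V[OF I] by (intro gens_subset) auto
    then show ?thesis using G[OF I] by (intro sets.determined_by_in_sets[of "G I"]) auto
  qed

  (* A common family of generators: each I has to be tested against cells that are refined by
     the generators needed for the other members of the index family. *)
  define \<G> where "\<G> = (\<Union>I\<in>\<J>. G I)"
  (* The generators that concern I; a subset s of them names the cell D s I, and distinct
     subsets name disjoint cells. *)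
  define H where "H I = \<G> \<inter> gens I" for I
  define C where "C s K = {z \<in> space N. \<forall>c\<in>\<G> \<inter> F K. z \<in> c \<longleftrightarrow> c \<in> s}" for s K
  define D where "D s I = (\<Inter>K\<in>{K\<in>\<K>. K \<subseteq> I}. C s K)" for s I
  have fin_\<G>: "finite \<G>" using finite_\<J> G by (auto simp: \<G>_def)
  then have fin_H: "finite (H I)" for I by (simp add: H_def)
  have C: "C s K \<in> F K" if "K \<subseteq> V" for s K
  proof -
    interpret FK: sigma_algebra "space N" "F K" by (rule F_sigma_algebra[OF that])
    have "{z \<in> space N. z \<in> c \<longleftrightarrow> c \<in> s} \<in> F K" if "c \<in> \<G> \<inter> F K" for c
    proof -
      have "{z \<in> space N. z \<in> c \<longleftrightarrow> c \<in> s} = (if c \<in> s then c else space N - c)"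
        using that FK.sets_into_space by auto
      then show ?thesis using that by auto
    qed
    then show ?thesis unfolding C_def using fin_\<G> by (intro FK.sets_Collect_finite_All) auto
  qed
  have D_iff: "z \<in> D s I \<longleftrightarrow> z \<in> space N \<and> (\<forall>c\<in>H I. z \<in> c \<longleftrightarrow> c \<in> s)" if "I \<in> \<J>" for z s I
  proof -
    define \<T> where "\<T> = {K. K \<subseteq> I \<and> card K \<le> Suc j}"
    have "{K\<in>\<K>. K \<subseteq> I} = \<T>" using that by (auto simp: \<K>_def \<T>_def)
    then have "z \<in> D s I \<longleftrightarrow> (\<forall>K\<in>\<T>. z \<in> space N \<and> (\<forall>c\<in>\<G> \<inter> F K. z \<in> c \<longleftrightarrow> c \<in> s))"
      unfolding D_def C_def by simp
    moreover have "{} \<in> \<T>" by (simp add: \<T>_def)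
    moreover have "H I = (\<Union>K\<in>\<T>. \<G> \<inter> F K)" unfolding H_def gens_def \<T>_def by simp
    ultimately show ?thesis by blast
  qed
  have D_F: "D s I \<in> F I" if I: "I \<in> \<J>" for s I
  proof -
    interpret FI: sigma_algebra "space N" "F I" by (rule F_sigma_algebra[OF \<J>_V[OF I]])
    have "C s K \<in> F I" if "K \<in> \<K>" "K \<subseteq> I" for K
      using C[OF \<K>_V[OF that(1)]] F_mono[OF that(2) \<J>_V[OF I]] by blast
    moreover have "{} \<in> {K\<in>\<K>. K \<subseteq> I}" using I by (auto simp: \<K>_def)
    ultimately show ?thesis unfolding D_def using fin_\<K> by (intro FI.finite_INT) auto
  qed
  have DA_F: "D s I - A I \<in> F I" if I: "I \<in> \<J>" for s I
  proof -
    interpret FI: sigma_algebra "space N" "F I" by (rule F_sigma_algebra[OF \<J>_V[OF I]])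
    show ?thesis using D_F AF I by auto
  qed

  have "\<forall>q\<in>UNIV \<times> \<J>. \<exists>Q. Q \<in> lower j (snd q) \<and>
      (\<forall>W \<in> transverse j (snd q). W \<subseteq> Q \<longrightarrow>
        measure N ((D (fst q) (snd q) - A (snd q)) \<inter> W) \<le> \<epsilon> * measure N (D (fst q) (snd q) \<inter> W)) \<and>
      \<epsilon> * measure N (D (fst q) (snd q) - Q) \<le> measure N ((D (fst q) (snd q) - A (snd q)) - Q)"
  proof
    fix q :: "'x set set \<times> 'i set" assume "q \<in> UNIV \<times> \<J>"
    then have q: "snd q \<in> \<J>" by auto
    show "\<exists>Q. Q \<in> lower j (snd q) \<and>
      (\<forall>W \<in> transverse j (snd q). W \<subseteq> Q \<longrightarrow>
        measure N ((D (fst q) (snd q) - A (snd q)) \<inter> W) \<le> \<epsilon> * measure N (D (fst q) (snd q) \<inter> W)) \<and>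
      \<epsilon> * measure N (D (fst q) (snd q) - Q) \<le> measure N ((D (fst q) (snd q) - A (snd q)) - Q)"
      by (rule density_level[OF \<J>_V[OF q] DA_F[OF q] D_F[OF q] \<epsilon>(1), of j]) blast
  qed
  from bchoice[OF this] obtain Q1 where Q1: "\<forall>q\<in>UNIV \<times> \<J>. Q1 q \<in> lower j (snd q) \<and>
      (\<forall>W \<in> transverse j (snd q). W \<subseteq> Q1 q \<longrightarrow>
        measure N ((D (fst q) (snd q) - A (snd q)) \<inter> W) \<le> \<epsilon> * measure N (D (fst q) (snd q) \<inter> W)) \<and>
      \<epsilon> * measure N (D (fst q) (snd q) - Q1 q) \<le> measure N ((D (fst q) (snd q) - A (snd q)) - Q1 q)"
    by blast
  define Q0 where "Q0 s I = Q1 (s, I)" for s I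
  have Q0: "Q0 s I \<in> lower j I"
    "\<And>W. W \<in> transverse j I \<Longrightarrow> W \<subseteq> Q0 s I \<Longrightarrow>
       measure N ((D s I - A I) \<inter> W) \<le> \<epsilon> * measure N (D s I \<inter> W)"
    "\<epsilon> * measure N (D s I - Q0 s I) \<le> measure N ((D s I - A I) - Q0 s I)"
    if "I \<in> \<J>" for s I
    using Q1[rule_format, of "(s, I)"] that by (auto simp: Q0_def)
  have Q0_F: "Q0 s I \<in> F I" if "I \<in> \<J>" for s I
    using Q0(1)[OF that] lower_subset_F[OF \<J>_V[OF that]] by blast
  have DN: "D s I \<in> sets N" "Q0 s I \<in> sets N" if "I \<in> \<J>" for s I
    using D_F Q0_F F_N that by blast+

  define Y where "Y I = A I - (\<Union>s\<in>Pow (H I). D s I \<inter> Q0 s I)" for I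
  have Y_F: "Y I \<in> F I" if I: "I \<in> \<J>" for I
  proof -
    interpret FI: sigma_algebra "space N" "F I" by (rule F_sigma_algebra[OF \<J>_V[OF I]])
    show ?thesis unfolding Y_def using AF[OF I] D_F[OF I] Q0_F[OF I] fin_H
      by (intro FI.Diff FI.finite_UN FI.Int) auto
  qed
  have Y_small: "measure N (Y I) \<le> \<delta> * (1 + 1 / \<epsilon>)" if I: "I \<in> \<J>" for I
  proof -
    define S where "S = {s \<in> Pow (H I). D s I \<subseteq> R I}"
    have fin_S: "finite S" using fin_H by (auto simp: S_def)
    have "Y I \<subseteq> (A I - R I) \<union> (\<Union>s\<in>S. D s I - Q0 s I)"
    proof
      fix z assume z: "z \<in> Y I"
      show "z \<in> (A I - R I) \<union> (\<Union>s\<in>S. D s I - Q0 s I)"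
      proof (cases "z \<in> R I")
        case False
        then show ?thesis using z by (auto simp: Y_def)
      next
        case True
        define s where "s = {c \<in> H I. z \<in> c}"
        have z_space: "z \<in> space N" using z AN[OF I] sets.sets_into_space by (auto simp: Y_def)
        then have zD: "z \<in> D s I" using D_iff[OF I] by (auto simp: s_def)
        have "D s I \<subseteq> R I"
        proof
          fix y assume "y \<in> D s I"
          then have y: "y \<in> space N" "\<And>c. c \<in> H I \<Longrightarrow> z \<in> c \<longleftrightarrow> y \<in> c"
            using D_iff[OF I] by (auto simp: s_def)
          have "G I \<subseteq> H I" using G(2)[OF I] I by (auto simp: H_def \<G>_def)
          then show "y \<in> R I" using y by (intro determined_byD[OF G(3)[OF I] True]) auto
        qed
        then have "s \<in> S" by (auto simp: S_def s_def)
        moreover have "z \<notin> Q0 s I" using z zD by (auto simp: Y_def s_def)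
        ultimately show ?thesis using zD by auto
      qed
    qed
    then have "measure N (Y I) \<le> measure N ((A I - R I) \<union> (\<Union>s\<in>S. D s I - Q0 s I))"
      using AN[OF I] RN[OF I] DN[OF I] fin_S
      by (intro finite_measure_mono sets.Un sets.finite_UN sets.Diff) auto
    also have "\<dots> \<le> measure N (A I - R I) + measure N (\<Union>s\<in>S. D s I - Q0 s I)"
      using AN[OF I] RN[OF I] DN[OF I] fin_S
      by (intro measure_Un_le sets.finite_UN sets.Diff) auto
    also have "measure N (\<Union>s\<in>S. D s I - Q0 s I) \<le> (\<Sum>s\<in>S. measure N (D s I - Q0 s I))"
      using DN[OF I] fin_S by (intro measure_UNION_le sets.Diff) auto
    also have "\<dots> \<le> (\<Sum>s\<in>S. 1 / \<epsilon> * measure N (D s I - A I))"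
    proof (rule sum_mono)
      fix s
      have "\<epsilon> * measure N (D s I - Q0 s I) \<le> measure N ((D s I - A I) - Q0 s I)"
        by (rule Q0(3)[OF I])
      also have "\<dots> \<le> measure N (D s I - A I)"
        using DN[OF I] AN[OF I] by (intro finite_measure_mono) auto
      finally show "measure N (D s I - Q0 s I) \<le> 1 / \<epsilon> * measure N (D s I - A I)"
        using \<epsilon>(1) by (simp add: field_simps)
    qed
    also have "\<dots> = 1 / \<epsilon> * measure N (\<Union>s\<in>S. D s I - A I)"
    proof -
      have "disjoint_family_on (\<lambda>s. D s I - A I) S"
      proof (unfold disjoint_family_on_def, intro ballI impI)
        fix s t assume st: "s \<in> S" "t \<in> S" "s \<noteq> t"
        then obtain c where "c \<in> H I" "c \<in> s \<longleftrightarrow> c \<notin> t" by (auto simp: S_def)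
        then show "(D s I - A I) \<inter> (D t I - A I) = {}" using D_iff[OF I] by auto
      qed
      then have "measure N (\<Union>s\<in>S. D s I - A I) = (\<Sum>s\<in>S. measure N (D s I - A I))"
        using DN[OF I] AN[OF I] fin_S by (intro finite_measure_finite_Union image_subsetI sets.Diff) auto
      then show ?thesis by (simp add: sum_distrib_left)
    qed
    also have "\<dots> \<le> 1 / \<epsilon> * measure N (R I - A I)"
      using DN[OF I] AN[OF I] RN[OF I] \<epsilon>(1) fin_S
      by (intro mult_left_mono finite_measure_mono) (auto simp: S_def)
    finally have "measure N (Y I) \<le> measure N (A I - R I) + 1 / \<epsilon> * measure N (R I - A I)" by simp
    also have "\<dots> \<le> \<delta> + 1 / \<epsilon> * \<delta>"
      using G(4,5)[OF I] \<epsilon>(1) by (intro add_mono mult_left_mono) auto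
    finally show ?thesis by (simp add: algebra_simps)
  qed

  (* A cell of the full partition determines its trace on I through s \<inter> H I, and Q0 must be
     taken at this canonical name: the union defining Y I only runs over subsets of H I. *)
  define Q where "Q s I = Q0 (s \<inter> H I) I" for s I
  define Z where "Z s = (\<Inter>K\<in>\<K>. C s K) \<inter> (\<Inter>I\<in>\<J>. Q s I)" for s
  have D_Int: "D (s \<inter> H I) I = D s I" if "I \<in> \<J>" for s I
    using D_iff[OF that] by auto
  have Z_le: "\<mu> (Z s) \<le> 0" for s
    unfolding Z_def \<K>_def
  proof (rule cell_null[OF descent _ _ _ null \<epsilon>(2)])
    fix I W assume I: "I \<in> \<J>" and W: "W \<in> transverse j I" "W \<subseteq> Q s I"
    have "measure N ((D s I - A I) \<inter> W) \<le> \<epsilon> * measure N (D s I \<inter> W)"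
      using Q0(2)[OF I W(1), of "s \<inter> H I"] W(2) D_Int[OF I] by (simp add: Q_def)
    then show "measure N ((\<Inter> (C s ` {K \<in> {K. card K \<le> Suc j \<and> (\<exists>I\<in>\<J>. K \<subseteq> I)}. K \<subseteq> I}) - A I) \<inter> W)
        \<le> \<epsilon> * measure N (\<Inter> (C s ` {K \<in> {K. card K \<le> Suc j \<and> (\<exists>I\<in>\<J>. K \<subseteq> I)}. K \<subseteq> I}) \<inter> W)"
      unfolding D_def \<K>_def by simp
  qed (use C \<K>_V Q0(1) AF in \<open>auto simp: \<K>_def Q_def\<close>)
  have ZN: "Z s \<in> sets N" for s
  proof -
    have "C s K \<in> sets N" if "K \<in> \<K>" for K using C F_sets \<K>_V[OF that] by blast
    moreover have "{} \<in> \<K>" using \<J>_nonempty by (auto simp: \<K>_def)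
    ultimately show ?thesis
      unfolding Z_def Q_def using DN(2) fin_\<K> finite_\<J> \<J>_nonempty
      by (intro sets.Int sets.finite_INT) auto
  qed
  have YN: "Y I \<in> sets N" if "I \<in> \<J>" for I using Y_F F_N that by blast
  have AAN: "(\<Inter>I\<in>\<J>. A I) \<in> sets N"
    using AN finite_\<J> \<J>_nonempty by (intro sets.finite_INT) auto
  have cover: "(\<Inter>I\<in>\<J>. A I) \<subseteq> (\<Union>I\<in>\<J>. Y I) \<union> (\<Union>s\<in>Pow \<G>. Z s)"
  proof
    fix x assume x: "x \<in> (\<Inter>I\<in>\<J>. A I)"
    show "x \<in> (\<Union>I\<in>\<J>. Y I) \<union> (\<Union>s\<in>Pow \<G>. Z s)"
    proof (cases "x \<in> (\<Union>I\<in>\<J>. Y I)")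
      case False
      have x_space: "x \<in> space N" using x AAN sets.sets_into_space by blast
      define s where "s = {c \<in> \<G>. x \<in> c}"
      have "x \<in> Q s I" if I: "I \<in> \<J>" for I
      proof -
        from False x I obtain t where t: "t \<subseteq> H I" "x \<in> D t I" "x \<in> Q0 t I"
          by (auto simp: Y_def)
        have "t = s \<inter> H I" using t(1,2) D_iff[OF I] by (auto simp: s_def H_def)
        then show ?thesis using t by (simp add: Q_def)
      qed
      moreover have "x \<in> C s K" for K using x_space by (auto simp: C_def s_def)
      ultimately have "x \<in> Z s" by (auto simp: Z_def)
      then show ?thesis by (auto simp: s_def)
    qed auto
  qed
  have "\<mu> (\<Inter>I\<in>\<J>. A I) \<le> \<mu> ((\<Union>I\<in>\<J>. Y I) \<union> (\<Union>s\<in>Pow \<G>. Z s))"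
    using AAN YN ZN finite_\<J> fin_\<G> cover
    by (intro \<mu>_mono sets.Un sets.finite_UN) auto
  also have "\<dots> \<le> \<mu> (\<Union>I\<in>\<J>. Y I) + \<mu> (\<Union>s\<in>Pow \<G>. Z s)"
    using YN ZN finite_\<J> fin_\<G> by (intro \<mu>_Un sets.finite_UN) auto
  also have "\<mu> (\<Union>s\<in>Pow \<G>. Z s) \<le> (\<Sum>s\<in>Pow \<G>. \<mu> (Z s))"
    using ZN fin_\<G> by (intro \<mu>_UN) auto
  also have "\<dots> \<le> 0" using Z_le by (intro sum_nonpos) auto
  also have "\<mu> (\<Union>I\<in>\<J>. Y I) \<le> (\<Sum>I\<in>\<J>. \<mu> (Y I))"
    using YN finite_\<J> by (intro \<mu>_UN) auto
  also have "\<dots> \<le> (\<Sum>I\<in>\<J>. k * (\<delta> * (1 + 1 / \<epsilon>)))"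
    using \<mu>_le Y_F Y_small k_pos by (intro sum_mono) (meson mult_left_mono less_imp_le order_trans)
  also have "\<dots> = \<eta>"
    using card_pos k_pos \<epsilon>(1) by (simp add: \<delta>_def divide_simps add_eq_0_iff)
  finally show "\<mu> (\<Inter>I\<in>\<J>. A I) \<le> 0 + \<eta>" by simp
qed

text \<open>The descent ends at level \<open>0\<close>, where every event is empty or the whole space and there is nothing to
remove; it starts at level \<open>card V\<close>, which contains all of \<open>F I\<close>.\<close>

theorem removal:
  assumes "\<And>I. I \<in> \<J> \<Longrightarrow> A I \<in> F I" "measure N (\<Inter>I\<in>\<J>. A I) = 0"
  shows "\<mu> (\<Inter>I\<in>\<J>. A I) \<le> 0"
proof -
  have "\<mu> (\<Inter>I\<in>\<J>. A I) \<le> 0"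
    if "\<And>I. I \<in> \<J> \<Longrightarrow> A I \<in> lower j I" "measure N (\<Inter>I\<in>\<J>. A I) = 0" for j A
    using that
  proof (induction j arbitrary: A)
    case 0
    have "lower 0 I \<subseteq> {{}, space N}" if "I \<in> \<J>" for I
    proof (rule join_least)
      fix K assume K: "K \<in> {K. K \<subseteq> I \<and> card K \<le> 0}"
      then have "finite K" using \<J>_V[OF that] finite_V by (auto intro: finite_subset)
      then show "F K \<subseteq> {{}, space N}" using K F_empty by auto
    qed (rule sigma_algebra_trivial)
    then have triv: "A I = {} \<or> A I = space N" if "I \<in> \<J>" for I using 0(1) that by blast
    show ?case
    proof (cases "\<exists>I\<in>\<J>. A I = {}")
      case True
      then have "(\<Inter>I\<in>\<J>. A I) = {}" by auto
      then show ?thesis using \<mu>_empty by simp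
    next
      case False
      then have "(\<Inter>I\<in>\<J>. A I) = space N" using triv \<J>_nonempty by auto
      then show ?thesis using 0(2) prob_space by simp
    qed
  next
    case (Suc j)
    show ?case by (rule descent_step[OF Suc.IH Suc.prems])
  qed
  moreover have "A I \<in> lower (card V) I" if "I \<in> \<J>" for I
  proof -
    have "card I \<le> card V" using \<J>_V[OF that] finite_V by (rule card_mono[rotated])
    then show ?thesis using assms(1)[OF that] F_subset_lower[of I I "card V"] by auto
  qed
  ultimately show ?thesis using assms(2) by blast
qed

end

section \<open>Finite-to-one images in a countably compact algebra\<close>

lemma sigma_sets_countable_generators:
  assumes "E \<in> sigma_sets \<Omega> \<D>"
  shows "\<exists>\<C>. countable \<C> \<and> \<C> \<subseteq> \<D> \<and> E \<in> sigma_sets \<Omega> \<C>"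
  using assms
proof induction
  case (Basic a)
  then show ?case by (intro exI[of _ "{a}"]) auto
next
  case Empty
  then show ?case by (intro exI[of _ "{}"]) (auto intro: sigma_sets.Empty)
next
  case (Compl a)
  then show ?case by (auto intro: sigma_sets.Compl)
next
  case (Union a)
  then have "\<forall>i. \<exists>\<C>. countable \<C> \<and> \<C> \<subseteq> \<D> \<and> a i \<in> sigma_sets \<Omega> \<C>" by simp
  from choice[OF this] obtain \<C> where \<C>: "\<And>i. countable (\<C> i)" "\<And>i. \<C> i \<subseteq> \<D>"
    "\<And>i. a i \<in> sigma_sets \<Omega> (\<C> i)" by auto
  have "a i \<in> sigma_sets \<Omega> (\<Union>i. \<C> i)" for i
    using \<C>(3)[of i] sigma_sets_mono'[of "\<C> i" "\<Union>i. \<C> i"] by blast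
  then have "(\<Union>i. a i) \<in> sigma_sets \<Omega> (\<Union>i. \<C> i)" by (rule sigma_sets.Union)
  then show ?case using \<C>(1,2) by (intro exI[of _ "\<Union>i. \<C> i"]) auto
qed

text \<open>With \<open>T\<close> a set of types over a countable family, coded by the members that they contain: finitely
many types are told apart by finitely many members of the family.\<close>

lemma separate_by_initial_segment:
  fixes T :: "nat set set"
  assumes "finite T"
  shows "\<exists>i. inj_on (\<lambda>\<kappa>. \<kappa> \<inter> {..<i}) T"
proof -
  have "\<forall>p\<in>T \<times> T. \<exists>j. fst p \<noteq> snd p \<longrightarrow> (j \<in> fst p \<longleftrightarrow> j \<notin> snd p)" by auto
  from bchoice[OF this] obtain w
    where w: "\<forall>p\<in>T \<times> T. fst p \<noteq> snd p \<longrightarrow> (w p \<in> fst p \<longleftrightarrow> w p \<notin> snd p)" by blast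
  have "finite (w ` (T \<times> T))" using assms by simp
  then obtain i where i: "\<And>n. n \<in> w ` (T \<times> T) \<Longrightarrow> n < i"
    by (auto simp: finite_nat_set_iff_bounded)
  have "inj_on (\<lambda>\<kappa>. \<kappa> \<inter> {..<i}) T"
  proof (rule inj_onI, rule ccontr)
    fix a b assume ab: "a \<in> T" "b \<in> T" "a \<inter> {..<i} = b \<inter> {..<i}" "a \<noteq> b"
    then have "w (a, b) < i" using i by auto
    moreover have "w (a, b) \<in> a \<longleftrightarrow> w (a, b) \<notin> b" using w ab by auto
    ultimately show False using ab(3) by auto
  qed
  then show ?thesis ..
qed

lemma decreasing_finite_Inter_nonempty:
  fixes K :: "nat \<Rightarrow> 'b set"
  assumes "\<And>m. finite (K m)" "\<And>m. K m \<noteq> {}" "decseq K"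
  shows "(\<Inter>m. K m) \<noteq> {}"
proof -
  obtain m where m: "\<And>m'. card (K m) \<le> card (K m')"
    using ex_has_least_nat[of "\<lambda>_. True" 0 "\<lambda>m. card (K m)"] by auto
  have "K m \<subseteq> K m'" for m'
  proof (cases "m \<le> m'")
    case True
    then have "K m' \<subseteq> K m" using assms(3) by (auto simp: decseq_def)
    then have "K m' = K m" using m assms(1) by (intro card_seteq) auto
    then show ?thesis by simp
  next
    case False
    then show ?thesis using assms(3) by (auto simp: decseq_def)
  qed
  then show ?thesis using assms(2)[of m] by blast
qed

text \<open>The property of the definable sets of a saturated structure that matters here: countably many of
them meet as soon as finitely many always do.\<close>

locale compact_algebra = algebra \<Omega> \<D> for \<Omega> :: "'x set" and \<D> +
  assumes compact: "(\<And>i::nat. D i \<in> \<D>) \<Longrightarrow> decseq D \<Longrightarrow> (\<And>i. D i \<noteq> {}) \<Longrightarrow> (\<Inter>i. D i) \<noteq> {}"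
    and singleton: "x \<in> \<Omega> \<Longrightarrow> {x} \<in> \<D>"
begin

text \<open>Remove the points found so far: the remaining sets still belong to the algebra, because points do,
and compactness provides one more point.\<close>

lemma many_points_in_Inter:
  fixes D :: "nat \<Rightarrow> 'x set"
  assumes "\<And>i. D i \<in> \<D>" "decseq D" "\<And>i. \<exists>T \<subseteq> D i. finite T \<and> card T = m"
  shows "\<exists>T \<subseteq> (\<Inter>i. D i). finite T \<and> card T = m"
  using assms
proof (induction m arbitrary: D)
  case 0
  then show ?case by (intro exI[of _ "{}"]) auto
next
  case (Suc m)
  have "D i \<noteq> {}" for i
  proof
    assume "D i = {}"
    with Suc.prems(3)[of i] show False by auto
  qed
  then obtain x where x: "x \<in> (\<Inter>i. D i)" using compact[OF Suc.prems(1,2)] by auto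
  then have "x \<in> \<Omega>" using Suc.prems(1) sets_into_space by blast
  have "\<exists>T \<subseteq> (\<Inter>i. D i - {x}). finite T \<and> card T = m"
  proof (rule Suc.IH)
    show "D i - {x} \<in> \<D>" for i using Suc.prems(1) singleton[OF \<open>x \<in> \<Omega>\<close>] by auto
    show "decseq (\<lambda>i. D i - {x})" using Suc.prems(2) by (auto simp: decseq_def)
    fix i
    obtain T where T: "T \<subseteq> D i" "finite T" "card T = Suc m" using Suc.prems(3) by blast
    have "m \<le> card (T - {x})" using T by (cases "x \<in> T") (auto simp: card_Diff_singleton)
    then obtain T' where "T' \<subseteq> T - {x}" "card T' = m" "finite T'"
      by (rule obtain_subset_with_card_n)
    then show "\<exists>T \<subseteq> D i - {x}. finite T \<and> card T = m" using T by blast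
  qed
  then obtain T where T: "T \<subseteq> (\<Inter>i. D i - {x})" "finite T" "card T = m" by auto
  then have "x \<notin> T" by auto
  then have "insert x T \<subseteq> (\<Inter>i. D i)" "finite (insert x T)" "card (insert x T) = Suc m"
    using T x by auto
  then show ?case by blast
qed

text \<open>Images of members of \<open>\<D>\<close> are measurable, but images do not in general commute with decreasing intersections, and for
general \<open>E\<close> the image is only analytic. With finite fibres they do commute, provided the fibres of the
sets to which the monotone class argument is applied are finite as well. Let a sequence \<open>d\<close> in \<open>\<D>\<close>
generate \<open>E\<close>, and let the code of a point record which \<open>d j\<close> contain it. If every cell of finitely
many \<open>d j\<close> around \<open>x \<in> E\<close> met the fibre of \<open>x\<close> in more than \<open>l\<close> codes, compactness would produce more than
\<open>l\<close> points of the fibre with the code of \<open>x\<close>, and all of them lie in \<open>E\<close>. Hence some cell \<open>C\<close> around \<open>x\<close>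
meets the fibre in at most \<open>l\<close> codes; \<open>U C\<close> is the measurable set of base points where this happens. Over
\<open>U C\<close> and inside \<open>C\<close>, decreasing intersections of sets determined by codes commute with \<open>\<pi>\<close>, so the
monotone class argument applies there, and the countably many pairs \<open>C\<close>, \<open>U C\<close> exhaust \<open>E\<close>.\<close>

theorem finite_to_one_image:
  fixes \<pi> :: "'x \<Rightarrow> 'y"
  assumes S: "sigma_algebra Y \<S>"
    and \<pi>: "\<And>x. x \<in> \<Omega> \<Longrightarrow> \<pi> x \<in> Y"
    and fibre: "\<And>y. y \<in> Y \<Longrightarrow> {x \<in> \<Omega>. \<pi> x = y} \<in> \<D>"
    and image: "\<And>D. D \<in> \<D> \<Longrightarrow> \<pi> ` D \<in> \<S>"
    and E: "E \<in> sigma_sets \<Omega> \<D>"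
    and l: "\<And>y. y \<in> Y \<Longrightarrow> finite {x \<in> E. \<pi> x = y} \<and> card {x \<in> E. \<pi> x = y} \<le> l"
  shows "\<pi> ` E \<in> \<S>"
proof -
  interpret S: sigma_algebra Y \<S> by (rule S)
  obtain \<C> where \<C>: "countable \<C>" "\<C> \<subseteq> \<D>" "E \<in> sigma_sets \<Omega> \<C>"
    using sigma_sets_countable_generators[OF E] by auto
  (* A sequence needs a nonempty range, hence the additional empty set. *)
  define d where "d = from_nat_into (insert {} \<C>)"
  have range_d: "range d = insert {} \<C>"
    unfolding d_def using \<C>(1) by (intro range_from_nat_into) auto
  have d: "d j \<in> \<D>" for j
    using range_d \<C>(2) empty_sets by (metis insert_subset rangeI subsetD)
  have Ed: "E \<in> sigma_sets \<Omega> (range d)"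
    using \<C>(3) sigma_sets_mono'[of \<C> "range d"] range_d by blast
  define code where "code x = {j. x \<in> d j}" for x
  define cell where "cell i s = {x \<in> \<Omega>. code x \<inter> {..<i} = s \<inter> {..<i}}" for i s
  have cell: "cell i s \<in> \<D>" for i s
  proof -
    have "cell i s = {x \<in> \<Omega>. \<forall>j\<in>{..<i}. x \<in> d j \<longleftrightarrow> j \<in> s}"
      by (auto simp: cell_def code_def)
    moreover have "{x \<in> \<Omega>. x \<in> d j \<longleftrightarrow> j \<in> s} \<in> \<D>" for j
    proof -
      have "{x \<in> \<Omega>. x \<in> d j \<longleftrightarrow> j \<in> s} = (if j \<in> s then d j else \<Omega> - d j)"
        using d[of j] sets_into_space by auto
      then show ?thesis using d by auto
    qed
    ultimately show ?thesis by (simp only:) (intro sets_Collect_finite_All, auto)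
  qed
  define types where "types C i y = {t \<in> Pow {..<i}. y \<in> \<pi> ` (C \<inter> cell i t)}" for C i y
  define U where "U C = {y \<in> Y. \<forall>i. card (types C i y) \<le> l}" for C
  have types_finite: "finite (types C i y)" for C i y by (auto simp: types_def)
  have U: "U C \<in> \<S>" if C: "C \<in> \<D>" for C
  proof -
    have "{y \<in> Y. card (types C i y) \<le> l} \<in> \<S>" for i
    proof (rule S.determined_by_in_sets)
      show "finite ((\<lambda>t. \<pi> ` (C \<inter> cell i t)) ` Pow {..<i})" by simp
      show "(\<lambda>t. \<pi> ` (C \<inter> cell i t)) ` Pow {..<i} \<subseteq> \<S>"
        using cell C by (auto intro!: image)
      have types_eq: "types C i x = types C i y"
        if "\<forall>c\<in>(\<lambda>t. \<pi> ` (C \<inter> cell i t)) ` Pow {..<i}. x \<in> c \<longleftrightarrow> y \<in> c" for x y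
        using that by (auto simp: types_def)
      show "determined_by Y ((\<lambda>t. \<pi> ` (C \<inter> cell i t)) ` Pow {..<i})
          {y \<in> Y. card (types C i y) \<le> l}"
        unfolding determined_by_def
      proof (intro conjI ballI impI)
        fix x y
        assume "\<forall>c\<in>(\<lambda>t. \<pi> ` (C \<inter> cell i t)) ` Pow {..<i}. x \<in> c \<longleftrightarrow> y \<in> c"
          and "x \<in> {y \<in> Y. card (types C i y) \<le> l}" "y \<in> Y"
        then show "y \<in> {y \<in> Y. card (types C i y) \<le> l}" using types_eq[of x y] by simp
      qed auto
    qed
    then have "(\<Inter>i. {y \<in> Y. card (types C i y) \<le> l}) \<in> \<S>" by (intro S.countable_INT) auto
    moreover have "(\<Inter>i. {y \<in> Y. card (types C i y) \<le> l}) = U C" by (auto simp: U_def)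
    ultimately show ?thesis by simp
  qed
  (* More than l codes would be separated at a finite stage i, where U counts them. *)
  have codes_finite: "finite (code ` {x \<in> C. \<pi> x = y})"
    if C: "C \<in> \<D>" and y: "y \<in> U C" for C y
  proof (rule ccontr)
    assume "infinite (code ` {x \<in> C. \<pi> x = y})"
    then obtain T where T: "T \<subseteq> code ` {x \<in> C. \<pi> x = y}" "finite T" "card T = Suc l"
      using infinite_arbitrarily_large[of "code ` {x \<in> C. \<pi> x = y}" "Suc l"] by blast
    obtain i where i: "inj_on (\<lambda>\<kappa>. \<kappa> \<inter> {..<i}) T"
      using separate_by_initial_segment[OF T(2)] by auto
    have "(\<lambda>\<kappa>. \<kappa> \<inter> {..<i}) ` T \<subseteq> types C i y"
    proof
      fix t assume "t \<in> (\<lambda>\<kappa>. \<kappa> \<inter> {..<i}) ` T"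
      then obtain x where x: "x \<in> C" "\<pi> x = y" "t = code x \<inter> {..<i}" using T(1) by auto
      moreover have "x \<in> \<Omega>" using x(1) C sets_into_space by auto
      ultimately have "x \<in> C \<inter> cell i t" by (auto simp: cell_def)
      then show "t \<in> types C i y" using x by (auto simp: types_def)
    qed
    then have "card ((\<lambda>\<kappa>. \<kappa> \<inter> {..<i}) ` T) \<le> card (types C i y)"
      using types_finite by (intro card_mono)
    then have "Suc l \<le> card (types C i y)" using i T by (simp add: card_image)
    then show False using y by (auto simp: U_def dest: spec[of _ i])
  qed
  let ?A = "{R. \<exists>G. finite G \<and> G \<subseteq> range d \<and> determined_by \<Omega> G R}"
  interpret A: algebra \<Omega> ?A by (rule algebra_finitely_determined)
  have "range d \<subseteq> Pow \<Omega>" using d sets_into_space by auto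
  from sigma_sets_finitely_determined[OF this Ed]
  have E_good: "determined_by \<Omega> (range d) E \<and> (\<forall>C\<in>\<D>. \<pi> ` (E \<inter> C) \<inter> U C \<in> \<S>)"
  proof (induction rule: A.monotone_class_induct)
    case (basic R)
    then obtain G where G: "finite G" "G \<subseteq> range d" "determined_by \<Omega> G R" by auto
    then have "R \<in> \<D>" using d by (intro determined_by_in_sets[of G]) auto
    then have "\<pi> ` (R \<inter> C) \<inter> U C \<in> \<S>" if "C \<in> \<D>" for C
      using that by (auto intro!: image U)
    then show ?case using determined_by_mono[OF G(3,2)] by simp
  next
    case (inc X)
    have det: "determined_by \<Omega> (range d) (X i)" for i using inc.IH by simp
    have "determined_by \<Omega> (range d) (\<Union>i. X i)"
    proof (rule determined_byI)
      show "(\<Union>i. X i) \<subseteq> \<Omega>" using det by (auto simp: determined_by_def)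
      show "y \<in> (\<Union>i. X i)"
        if "x \<in> (\<Union>i. X i)" "y \<in> \<Omega>" "\<And>c. c \<in> range d \<Longrightarrow> x \<in> c \<longleftrightarrow> y \<in> c" for x y
        using that determined_byD[OF det, of x _ y] by blast
    qed
    moreover have "\<pi> ` ((\<Union>i. X i) \<inter> C) \<inter> U C \<in> \<S>" if "C \<in> \<D>" for C
    proof -
      have "\<pi> ` ((\<Union>i. X i) \<inter> C) \<inter> U C = (\<Union>i. \<pi> ` (X i \<inter> C) \<inter> U C)" by auto
      moreover have "(\<Union>i. \<pi> ` (X i \<inter> C) \<inter> U C) \<in> \<S>"
        using inc.IH that by (intro S.countable_UN) auto
      ultimately show ?thesis by (simp only:)
    qed
    ultimately show ?case by simp
  next
    case (dec X)
    have det: "determined_by \<Omega> (range d) (X i)" for i using dec.IH by simp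
    have "determined_by \<Omega> (range d) (\<Inter>i. X i)"
    proof (rule determined_byI)
      show "(\<Inter>i. X i) \<subseteq> \<Omega>" using det[of 0] by (auto simp: determined_by_def)
      show "y \<in> (\<Inter>i. X i)"
        if "x \<in> (\<Inter>i. X i)" "y \<in> \<Omega>" "\<And>c. c \<in> range d \<Longrightarrow> x \<in> c \<longleftrightarrow> y \<in> c" for x y
        using that determined_byD[OF det, of x _ y] by blast
    qed
    moreover have "\<pi> ` ((\<Inter>i. X i) \<inter> C) \<inter> U C \<in> \<S>" if C: "C \<in> \<D>" for C
    proof -
      have "\<pi> ` ((\<Inter>i. X i) \<inter> C) \<inter> U C = (\<Inter>i. \<pi> ` (X i \<inter> C) \<inter> U C)"
      proof
        show "(\<Inter>i. \<pi> ` (X i \<inter> C) \<inter> U C) \<subseteq> \<pi> ` ((\<Inter>i. X i) \<inter> C) \<inter> U C"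
        proof
          fix y assume y: "y \<in> (\<Inter>i. \<pi> ` (X i \<inter> C) \<inter> U C)"
          (* The codes, rather than the points, that occur in X m over y: only these are finitely many. *)
          define K where "K m = code ` {x \<in> X m \<inter> C. \<pi> x = y}" for m
          have "(\<Inter>m. K m) \<noteq> {}"
          proof (rule decreasing_finite_Inter_nonempty)
            show "finite (K m)" for m
            proof (rule finite_subset)
              show "K m \<subseteq> code ` {x \<in> C. \<pi> x = y}" unfolding K_def by (intro image_mono) auto
              show "finite (code ` {x \<in> C. \<pi> x = y})" using y by (intro codes_finite[OF C]) simp
            qed
            show "K m \<noteq> {}" for m using y by (auto simp: K_def)
            show "decseq K"
            proof (unfold decseq_def, intro allI impI)
              fix m n :: nat assume "m \<le> n"
              then have "X n \<subseteq> X m" using dec.hyps(2) by (auto simp: decseq_def)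
              then show "K n \<subseteq> K m" unfolding K_def by (intro image_mono) auto
            qed
          qed
          then obtain \<kappa> where \<kappa>: "\<And>m. \<kappa> \<in> K m" by auto
          from \<kappa>[of 0] obtain x where x: "x \<in> C" "\<pi> x = y" "code x = \<kappa>"
            unfolding K_def by blast
          have "x \<in> X m" for m
          proof -
            obtain x' where x': "x' \<in> X m" "code x' = code x" using \<kappa>[of m] x(3)
              unfolding K_def by blast
            have "x \<in> \<Omega>" using x(1) C sets_into_space by auto
            then show ?thesis
            proof (rule determined_byD[OF det[of m] x'(1)])
              show "x' \<in> c \<longleftrightarrow> x \<in> c" if "c \<in> range d" for c
                using x'(2) that unfolding code_def by blast
            qed
          qed
          then show "y \<in> \<pi> ` ((\<Inter>i. X i) \<inter> C) \<inter> U C" using x y by auto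
        qed
      qed auto
      moreover have "(\<Inter>i. \<pi> ` (X i \<inter> C) \<inter> U C) \<in> \<S>"
        using dec.IH C by (intro S.countable_INT) auto
      ultimately show ?thesis by (simp only:)
    qed
    ultimately show ?case by simp
  qed
  have "\<pi> ` E = (\<Union>i. \<Union>s\<in>Pow {..<i}. \<pi> ` (E \<inter> cell i s) \<inter> U (cell i s))"
  proof
    show "\<pi> ` E \<subseteq> (\<Union>i. \<Union>s\<in>Pow {..<i}. \<pi> ` (E \<inter> cell i s) \<inter> U (cell i s))"
    proof
      fix y assume "y \<in> \<pi> ` E"
      then obtain x where x: "x \<in> E" "\<pi> x = y" by auto
      have x\<Omega>: "x \<in> \<Omega>" using x(1) E sigma_sets_into_sp[OF space_closed] by auto
      then have yY: "y \<in> Y" using x \<pi> by auto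
      define D where "D i = cell i (code x) \<inter> {z \<in> \<Omega>. \<pi> z = y}" for i
      have "\<exists>i. y \<in> U (cell i (code x))"
      proof (rule ccontr)
        assume contra: "\<nexists>i. y \<in> U (cell i (code x))"
        have "\<exists>T \<subseteq> (\<Inter>i. D i). finite T \<and> card T = Suc l"
        proof (rule many_points_in_Inter)
          show "D i \<in> \<D>" for i unfolding D_def using cell fibre[OF yY] by auto
          show "decseq D"
          proof (unfold decseq_def, intro allI impI subsetI)
            fix m n z assume mn: "m \<le> n" "z \<in> D n"
            have trunc: "\<kappa> \<inter> {..<m} = (\<kappa> \<inter> {..<n}) \<inter> {..<m}" for \<kappa> using mn(1) by auto
            have "code z \<inter> {..<n} = code x \<inter> {..<n}" using mn(2) by (simp add: D_def cell_def)
            then have "code z \<inter> {..<m} = code x \<inter> {..<m}" by (metis trunc)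
            then show "z \<in> D m" using mn(2) by (simp add: D_def cell_def)
          qed
          fix i
          have "\<exists>i'. card (types (cell i (code x)) i' y) > l"
            using contra yY by (auto simp: U_def not_le)
          then obtain i' where i': "Suc l \<le> card (types (cell i (code x)) i' y)"
            by (auto simp: Suc_le_eq)
          have "\<forall>t\<in>types (cell i (code x)) i' y. \<exists>z. z \<in> cell i (code x) \<inter> cell i' t \<and> \<pi> z = y"
            by (auto simp: types_def)
          from bchoice[OF this] obtain z where
            z: "\<forall>t\<in>types (cell i (code x)) i' y. z t \<in> cell i (code x) \<inter> cell i' t \<and> \<pi> (z t) = y"
            by blast
          have "inj_on z (types (cell i (code x)) i' y)"
          proof (rule inj_onI)
            fix s t assume st: "s \<in> types (cell i (code x)) i' y" "t \<in> types (cell i (code x)) i' y"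
              and eq: "z s = z t"
            then have "z s \<in> cell i' s" "z s \<in> cell i' t" using z by auto
            then have "s \<inter> {..<i'} = t \<inter> {..<i'}" by (auto simp: cell_def)
            moreover have "s \<subseteq> {..<i'}" "t \<subseteq> {..<i'}" using st by (auto simp: types_def)
            ultimately show "s = t" by auto
          qed
          then have "Suc l \<le> card (z ` types (cell i (code x)) i' y)"
            using i' by (simp add: card_image)
          then obtain T where T: "T \<subseteq> z ` types (cell i (code x)) i' y" "card T = Suc l" "finite T"
            by (rule obtain_subset_with_card_n)
          moreover have "z ` types (cell i (code x)) i' y \<subseteq> D i"
            using z by (auto simp: D_def cell_def)
          ultimately show "\<exists>T \<subseteq> D i. finite T \<and> card T = Suc l"
            by (intro exI[of _ T] conjI order_trans[OF T(1)])
        qed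
        then obtain T where T: "T \<subseteq> (\<Inter>i. D i)" "finite T" "card T = Suc l" by auto
        have "T \<subseteq> {x \<in> E. \<pi> x = y}"
        proof
          fix z assume "z \<in> T"
          then have z: "z \<in> D i" for i using T by auto
          have "j \<in> code z \<longleftrightarrow> j \<in> code x" for j
            using z[of "Suc j"] by (auto simp: D_def cell_def set_eq_iff)
          then have "x \<in> d j \<longleftrightarrow> z \<in> d j" for j by (simp add: code_def)
          moreover have "z \<in> \<Omega>" using z[of 0] by (simp add: D_def)
          ultimately have "z \<in> E"
            using determined_byD[OF conjunct1[OF E_good] x(1), of z] by blast
          then show "z \<in> {x \<in> E. \<pi> x = y}" using z[of 0] by (auto simp: D_def)
        qed
        then have "Suc l \<le> card {x \<in> E. \<pi> x = y}" using T(3) l[OF yY] card_mono[of "{x \<in> E. \<pi> x = y}" T] by simp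
        then show False using l[OF yY] by simp
      qed
      then obtain i where i: "y \<in> U (cell i (code x))" by auto
      have "cell i (code x \<inter> {..<i}) = cell i (code x)" by (auto simp: cell_def)
      moreover have "x \<in> cell i (code x)" using x\<Omega> by (auto simp: cell_def)
      ultimately have "y \<in> \<pi> ` (E \<inter> cell i (code x \<inter> {..<i})) \<inter> U (cell i (code x \<inter> {..<i}))"
        using x i by auto
      then show "y \<in> (\<Union>i. \<Union>s\<in>Pow {..<i}. \<pi> ` (E \<inter> cell i s) \<inter> U (cell i s))"
        by (intro UN_I[of i] UN_I[of "code x \<inter> {..<i}"]) auto
    qed
  qed auto
  moreover have "(\<Union>s\<in>Pow {..<i}. \<pi> ` (E \<inter> cell i s) \<inter> U (cell i s)) \<in> \<S>" for i
    using E_good cell by (intro S.finite_UN) auto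
  ultimately show ?thesis by auto
qed

end

section \<open>Definable sets\<close>

lemma eval_tm_cong:
  "(\<And>v. v \<in> vars_tm t \<Longrightarrow> e v = e' v) \<Longrightarrow> eval_tm M e t = eval_tm M e' t"
proof (induction t)
  case (Fn f ts)
  then have "map (eval_tm M e) ts = map (eval_tm M e') ts" by (intro map_cong) auto
  then show ?case by (simp only: eval_tm.simps)
qed auto

lemma sat_cong:
  "(\<And>v. v \<in> free_vars \<phi> \<Longrightarrow> e v = e' v) \<Longrightarrow> sat M e \<phi> \<longleftrightarrow> sat M e' \<phi>"
proof (induction \<phi> arbitrary: e e')
  case (Eq t u)
  then have "eval_tm M e t = eval_tm M e' t" "eval_tm M e u = eval_tm M e' u"
    by (auto intro: eval_tm_cong)
  then show ?case by simp
next
  case (Rel r ts)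
  then have "map (eval_tm M e) ts = map (eval_tm M e') ts"
    by (intro map_cong eval_tm_cong) auto
  then show ?case by (simp only: sat.simps)
next
  case (Neg \<phi>)
  have "sat M e \<phi> \<longleftrightarrow> sat M e' \<phi>" using Neg.prems by (intro Neg.IH) simp
  then show ?case by simp
next
  case (Conj \<phi> \<psi>)
  have "sat M e \<phi> \<longleftrightarrow> sat M e' \<phi>" using Conj.prems by (intro Conj.IH(1)) simp
  moreover have "sat M e \<psi> \<longleftrightarrow> sat M e' \<psi>" using Conj.prems by (intro Conj.IH(2)) simp
  ultimately show ?case by simp
next
  case (Exi v \<phi>)
  then have "sat M (e(v := a)) \<phi> \<longleftrightarrow> sat M (e'(v := a)) \<phi>" for a
    by (intro Exi.IH) auto
  then show ?case by simp
qed

primrec params_tm :: "('s, 'f, 'a) tm \<Rightarrow> ('s \<times> 'a) set" where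
  "params_tm (Var v) = {}"
| "params_tm (Par s a) = {(s, a)}"
| "params_tm (Fn f ts) = \<Union> (set (map params_tm ts))"

primrec params :: "('s, 'f, 'r, 'a) fm \<Rightarrow> ('s \<times> 'a) set" where
  "params (Eq t u) = params_tm t \<union> params_tm u"
| "params (Rel r ts) = \<Union> (set (map params_tm ts))"
| "params (Neg \<phi>) = params \<phi>"
| "params (Conj \<phi> \<psi>) = params \<phi> \<union> params \<psi>"
| "params (Exi v \<phi>) = params \<phi>"

lemma finite_params_tm: "finite (params_tm t)"
  by (induction t) auto

lemma finite_params: "finite (params \<phi>)"
  by (induction \<phi>) (auto simp: finite_params_tm)

text \<open>A formula only needs the parameters that occur in it, so countably many formulas live over a
countable parameter set, as saturation demands.\<close>

lemma is_tm_restrict: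
  "is_tm L A t s \<Longrightarrow> A \<inter> params_tm t \<subseteq> B \<Longrightarrow> is_tm L B t s"
proof (induction rule: is_tm.induct)
  case (var s i)
  then show ?case by (intro is_tm.var)
next
  case (par s a)
  then show ?case by (intro is_tm.par) auto
next
  case (fn f ts)
  have "list_all2 (is_tm L B) ts (fun_args L f)"
    unfolding list_all2_conv_all_nth
  proof (intro conjI allI impI)
    show "length ts = length (fun_args L f)" using fn.IH by (rule list_all2_lengthD)
    fix i assume i: "i < length ts"
    then have "params_tm (ts ! i) \<subseteq> params_tm (Fn f ts)" by fastforce
    then have "A \<inter> params_tm (ts ! i) \<subseteq> B" using fn.prems by blast
    then show "is_tm L B (ts ! i) (fun_args L f ! i)"
      using list_all2_nthD[OF fn.IH i] by simp
  qed
  then show ?case using fn.hyps by (intro is_tm.fn)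
qed

lemma is_fm_restrict:
  "is_fm L A \<phi> \<Longrightarrow> A \<inter> params \<phi> \<subseteq> B \<Longrightarrow> is_fm L B \<phi>"
proof (induction \<phi>)
  case (Eq t u)
  then obtain s where s: "is_tm L A t s" "is_tm L A u s" by auto
  have "A \<inter> params_tm t \<subseteq> B" "A \<inter> params_tm u \<subseteq> B" using Eq.prems(2) by auto
  then have "is_tm L B t s" "is_tm L B u s" using s by (simp_all add: is_tm_restrict)
  then show ?case by auto
next
  case (Rel r ts)
  have "list_all2 (is_tm L B) ts (rel_args L r)"
    unfolding list_all2_conv_all_nth
  proof (intro conjI allI impI)
    show "length ts = length (rel_args L r)" using Rel.prems by (auto dest: list_all2_lengthD)
    fix i assume i: "i < length ts"
    then have "params_tm (ts ! i) \<subseteq> params (Rel r ts)" by fastforce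
    then have "A \<inter> params_tm (ts ! i) \<subseteq> B" using Rel.prems(2) by blast
    moreover have "is_tm L A (ts ! i) (rel_args L r ! i)"
      using Rel.prems i by (auto dest: list_all2_nthD)
    ultimately show "is_tm L B (ts ! i) (rel_args L r ! i)" by (rule is_tm_restrict[rotated])
  qed
  then show ?case using Rel.prems by simp
qed auto

text \<open>Instantiation of free variables by parameters turns a definable set into a fibre of it. Parameters
  contain no variables, so there is no capture; only the instantiation of a variable must be
  suspended below a quantifier that binds it.\<close>

primrec inst_tm :: "('s \<times> nat \<Rightarrow> 'a option) \<Rightarrow> ('s, 'f, 'a) tm \<Rightarrow> ('s, 'f, 'a) tm" where
  "inst_tm \<theta> (Var v) = (case \<theta> v of None \<Rightarrow> Var v | Some a \<Rightarrow> Par (fst v) a)"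
| "inst_tm \<theta> (Par s a) = Par s a"
| "inst_tm \<theta> (Fn f ts) = Fn f (map (inst_tm \<theta>) ts)"

primrec inst :: "('s \<times> nat \<Rightarrow> 'a option) \<Rightarrow> ('s, 'f, 'r, 'a) fm \<Rightarrow> ('s, 'f, 'r, 'a) fm" where
  "inst \<theta> (Eq t u) = Eq (inst_tm \<theta> t) (inst_tm \<theta> u)"
| "inst \<theta> (Rel r ts) = Rel r (map (inst_tm \<theta>) ts)"
| "inst \<theta> (Neg \<phi>) = Neg (inst \<theta> \<phi>)"
| "inst \<theta> (Conj \<phi> \<psi>) = Conj (inst \<theta> \<phi>) (inst \<theta> \<psi>)"
| "inst \<theta> (Exi v \<phi>) = Exi v (inst (\<theta>(v := None)) \<phi>)"

definition override :: "('v \<Rightarrow> 'a) \<Rightarrow> ('v \<Rightarrow> 'a option) \<Rightarrow> 'v \<Rightarrow> 'a" where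
  "override e \<theta> v = (case \<theta> v of None \<Rightarrow> e v | Some a \<Rightarrow> a)"

lemma eval_inst_tm: "eval_tm M e (inst_tm \<theta> t) = eval_tm M (override e \<theta>) t"
proof (induction t)
  case (Var v)
  then show ?case by (auto simp: override_def split: option.split)
next
  case (Fn f ts)
  then have "map (eval_tm M e) (map (inst_tm \<theta>) ts) = map (eval_tm M (override e \<theta>)) ts"
    by (simp add: o_def)
  then show ?case by (simp only: eval_tm.simps inst_tm.simps)
qed simp

lemma sat_inst: "sat M e (inst \<theta> \<phi>) \<longleftrightarrow> sat M (override e \<theta>) \<phi>"
proof (induction \<phi> arbitrary: e \<theta>)
  case (Eq t u)
  then show ?case by (simp add: eval_inst_tm)
next
  case (Rel r ts)
  have "map (eval_tm M e) (map (inst_tm \<theta>) ts) = map (eval_tm M (override e \<theta>)) ts"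
    by (simp add: o_def eval_inst_tm)
  then show ?case by (simp only: sat.simps inst.simps)
next
  case (Exi v \<phi>)
  have "override (e(v := a)) (\<theta>(v := None)) = (override e \<theta>)(v := a)" for a
    by (rule ext) (simp add: override_def split: option.split)
  then show ?case by (simp only: inst.simps sat.simps Exi.IH)
qed auto

lemma vars_inst_tm: "vars_tm (inst_tm \<theta> t) = vars_tm t - dom \<theta>"
  by (induction t) (auto split: option.split)

lemma free_vars_inst: "free_vars (inst \<theta> \<phi>) = free_vars \<phi> - dom \<theta>"
  by (induction \<phi> arbitrary: \<theta>) (auto simp: vars_inst_tm)

lemma is_tm_inst:
  assumes \<theta>: "\<And>v a. \<theta> v = Some a \<Longrightarrow> (fst v, a) \<in> A"
  shows "is_tm L A t s \<Longrightarrow> is_tm L A (inst_tm \<theta> t) s"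
proof (induction rule: is_tm.induct)
  case (var s i)
  then show ?case using \<theta>[of "(s, i)"] by (auto intro: is_tm.intros split: option.split)
next
  case (par s a)
  then show ?case by (auto intro: is_tm.intros)
next
  case (fn f ts)
  have "list_all2 (is_tm L A) (map (inst_tm \<theta>) ts) (fun_args L f)"
    unfolding list_all2_map1 by (rule list_all2_mono[OF fn.IH]) simp
  then show ?case using is_tm.fn[OF fn.hyps] by simp
qed

lemma is_fm_inst:
  assumes "is_fm L A \<phi>" "\<And>v a. \<theta> v = Some a \<Longrightarrow> (fst v, a) \<in> A"
  shows "is_fm L A (inst \<theta> \<phi>)"
  using assms
proof (induction \<phi> arbitrary: \<theta>)
  case (Eq t u)
  then obtain s where "is_tm L A t s" "is_tm L A u s" by auto
  then show ?case using is_tm_inst[OF Eq.prems(2), of \<theta>] by auto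
next
  case (Rel r ts)
  have "list_all2 (is_tm L A) ts (rel_args L r)" using Rel.prems(1) by simp
  then have "list_all2 (\<lambda>t s. is_tm L A (inst_tm \<theta> t) s) ts (rel_args L r)"
    by (rule list_all2_mono) (rule is_tm_inst[OF Rel.prems(2)])
  then show ?case using Rel.prems(1) by (simp add: list_all2_map1)
next
  case (Neg \<phi>)
  then show ?case using Neg.IH[of \<theta>] by simp
next
  case (Conj \<phi> \<psi>)
  then show ?case using Conj.IH[of \<theta>] by simp
next
  case (Exi v \<phi>)
  have "is_fm L A (inst (\<theta>(v := None)) \<phi>)"
  proof (rule Exi.IH)
    show "is_fm L A \<phi>" using Exi.prems(1) by simp
    show "(fst w, a) \<in> A" if "(\<theta>(v := None)) w = Some a" for w a
      using that Exi.prems(2)[of w a] by (auto split: if_splits)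
  qed
  then show ?case using Exi.prems(1) by simp
qed

abbreviation env :: "(nat \<Rightarrow> 'a) \<Rightarrow> 's \<times> nat \<Rightarrow> 'a" where
  "env x \<equiv> \<lambda>(s, i). x i"

text \<open>A nonempty \<open>V\<close> provides a sort, without which there might be no closed formula, and so none to define the
one-point set \<open>tuples M \<sigma> {}\<close>.\<close>

locale sorted_structure =
  fixes L :: "('s, 'f, 'r) lang" and M :: "('s, 'f, 'r, 'a) struct" and \<sigma> :: "nat \<Rightarrow> 's"
    and V :: "nat set"
  assumes structure_M: "is_structure L M"
    and saturated: "aleph1_saturated L M"
    and finite_V: "finite V" and V_nonempty: "V \<noteq> {}"
    and sorts: "i \<in> V \<Longrightarrow> \<sigma> i \<in> sorts L"
begin

abbreviation T :: "nat set \<Rightarrow> (nat \<Rightarrow> 'a) set" where "T \<equiv> tuples M \<sigma>"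
abbreviation Df :: "nat set \<Rightarrow> (nat \<Rightarrow> 'a) set set" where "Df \<equiv> definable_sets L M \<sigma>"
abbreviation B :: "nat set \<Rightarrow> (nat \<Rightarrow> 'a) measure" where "B \<equiv> definable_algebra L M \<sigma>"
abbreviation vars :: "nat set \<Rightarrow> ('s \<times> nat) set" where "vars I \<equiv> (\<lambda>i. (\<sigma> i, i)) ` I"

lemma definableI:
  "is_fm L (elements L M) \<phi> \<Longrightarrow> free_vars \<phi> \<subseteq> vars I \<Longrightarrow> {x \<in> T I. sat M (env x) \<phi>} \<in> Df I"
  unfolding definable_sets_def by blast

lemma definableE:
  assumes "D \<in> Df I"
  obtains \<phi> where "is_fm L (elements L M) \<phi>" "free_vars \<phi> \<subseteq> vars I"
    "D = {x \<in> T I. sat M (env x) \<phi>}"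
  using assms unfolding definable_sets_def by blast

lemma T_definable: "T I \<in> Df I"
proof -
  obtain i where "i \<in> V" using V_nonempty by auto
  then have s: "\<sigma> i \<in> sorts L" by (rule sorts)
  let ?\<phi> = "Exi (\<sigma> i, 0) (Eq (Var (\<sigma> i, 0)) (Var (\<sigma> i, 0))) :: ('s, 'f, 'r, 'a) fm"
  have "is_fm L (elements L M) ?\<phi>" using s by (auto intro: is_tm.var)
  then have "{x \<in> T I. sat M (env x) ?\<phi>} \<in> Df I" by (intro definableI) auto
  moreover have "domain M (\<sigma> i) \<noteq> {}" using structure_M s by (auto simp: is_structure_def)
  then have "{x \<in> T I. sat M (env x) ?\<phi>} = T I" by auto
  ultimately show ?thesis by simp
qed

lemma algebra_definable: "algebra (T I) (Df I)"
  unfolding algebra_iff_Int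
proof (intro conjI ballI)
  show "Df I \<subseteq> Pow (T I)" unfolding definable_sets_def by blast
  have compl: "T I - a \<in> Df I" if "a \<in> Df I" for a
    using that
  proof (rule definableE)
    fix \<phi> assume \<phi>: "is_fm L (elements L M) \<phi>" "free_vars \<phi> \<subseteq> vars I"
      "a = {x \<in> T I. sat M (env x) \<phi>}"
    have "T I - a = {x \<in> T I. sat M (env x) (Neg \<phi>)}" unfolding \<phi>(3) by auto
    also have "\<dots> \<in> Df I" using \<phi> by (intro definableI) auto
    finally show ?thesis .
  qed
  then show "T I - a \<in> Df I" if "a \<in> Df I" for a using that .
  show "{} \<in> Df I" using compl[OF T_definable] by simp
  fix a b assume "a \<in> Df I" "b \<in> Df I"
  then obtain \<phi> \<psi> where \<phi>: "is_fm L (elements L M) \<phi>" "free_vars \<phi> \<subseteq> vars I"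
      "a = {x \<in> T I. sat M (env x) \<phi>}" and \<psi>: "is_fm L (elements L M) \<psi>" "free_vars \<psi> \<subseteq> vars I"
      "b = {x \<in> T I. sat M (env x) \<psi>}" by (elim definableE) blast
  have "a \<inter> b = {x \<in> T I. sat M (env x) (Conj \<phi> \<psi>)}" unfolding \<phi>(3) \<psi>(3) by auto
  also have "\<dots> \<in> Df I" using \<phi> \<psi> by (intro definableI) auto
  finally show "a \<inter> b \<in> Df I" .
qed

lemma Df_Pow: "Df I \<subseteq> Pow (T I)"
  unfolding definable_sets_def by blast

lemma space_B [simp]: "space (B I) = T I"
  using Df_Pow by (simp add: definable_algebra_def)

lemma sets_B: "sets (B I) = sigma_sets (T I) (Df I)"
  using Df_Pow by (simp add: definable_algebra_def)

lemma Df_sets_B: "D \<in> Df I \<Longrightarrow> D \<in> sets (B I)"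
  by (simp add: sets_B)

lemma measurable_into_B:
  assumes "\<And>x. x \<in> space N \<Longrightarrow> g x \<in> T I"
    and "\<And>D. D \<in> Df I \<Longrightarrow> {x \<in> space N. g x \<in> D} \<in> sets N"
  shows "g \<in> measurable N (B I)"
proof (rule measurable_sigma_sets[OF sets_B Df_Pow])
  show "g \<in> space N \<rightarrow> T I" using assms(1) by auto
  fix D assume "D \<in> Df I"
  then have "{x \<in> space N. g x \<in> D} \<in> sets N" by (rule assms(2))
  moreover have "g -` D \<inter> space N = {x \<in> space N. g x \<in> D}" by auto
  ultimately show "g -` D \<inter> space N \<in> sets N" by simp
qed

lemma coordinate_definable:
  assumes "i \<in> I" "i \<in> V" "a \<in> domain M (\<sigma> i)"
  shows "{x \<in> T I. x i = a} \<in> Df I"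
proof -
  have "(\<sigma> i, a) \<in> elements L M" using assms sorts by (auto simp: elements_def)
  then have "is_fm L (elements L M) (Eq (Var (\<sigma> i, i)) (Par (\<sigma> i) a))"
    using sorts assms(2) by (auto intro!: is_tm.intros exI[of _ "\<sigma> i"])
  then have "{x \<in> T I. sat M (env x) (Eq (Var (\<sigma> i, i)) (Par (\<sigma> i) a))} \<in> Df I"
    using assms by (intro definableI) auto
  then show ?thesis by simp
qed

lemma fibre_definable:
  assumes "K \<subseteq> I" "I \<subseteq> V" "y \<in> T K"
  shows "{x \<in> T I. proj K x = y} \<in> Df I"
proof -
  interpret algebra "T I" "Df I" by (rule algebra_definable)
  have "finite K" using assms(1,2) finite_V by (meson finite_subset)
  have "{x \<in> T I. x i = y i} \<in> Df I" if "i \<in> K" for i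
    using that assms by (intro coordinate_definable) (auto simp: tuples_def PiE_def Pi_def)
  then have "{x \<in> T I. \<forall>i\<in>K. x i = y i} \<in> Df I"
    using \<open>finite K\<close> by (intro sets_Collect_finite_All) auto
  moreover have "proj K x = y \<longleftrightarrow> (\<forall>i\<in>K. x i = y i)" for x
  proof
    assume "\<forall>i\<in>K. x i = y i"
    moreover have "y \<in> extensional K" using assms(3) by (auto simp: tuples_def PiE_def)
    ultimately show "proj K x = y" by (intro extensionalityI[of _ K]) auto
  qed (auto simp: restrict_def)
  ultimately show ?thesis by simp
qed

lemma proj_T: "x \<in> T I \<Longrightarrow> K \<subseteq> I \<Longrightarrow> proj K x \<in> T K"
  by (auto simp: tuples_def PiE_def Pi_def)

lemma proj_self: "x \<in> T I \<Longrightarrow> proj I x = x"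
  by (auto simp: tuples_def PiE_def extensional_restrict)

lemma pullback_definable:
  assumes "K \<subseteq> I" "D \<in> Df K"
  shows "{x \<in> T I. proj K x \<in> D} \<in> Df I"
  using assms(2)
proof (rule definableE)
  fix \<phi> assume \<phi>: "is_fm L (elements L M) \<phi>" "free_vars \<phi> \<subseteq> vars K"
      "D = {x \<in> T K. sat M (env x) \<phi>}"
  have "sat M (env (proj K x)) \<phi> \<longleftrightarrow> sat M (env x) \<phi>" for x
    by (rule sat_cong) (use \<phi>(2) in auto)
  then have "{x \<in> T I. proj K x \<in> D} = {x \<in> T I. sat M (env x) \<phi>}"
    unfolding \<phi>(3) using proj_T[OF _ assms(1)] by (simp only: mem_Collect_eq) blast
  also have "\<dots> \<in> Df I" using \<phi>(1,2) assms(1) by (intro definableI) auto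
  finally show ?thesis .
qed

lemma measurable_proj: "K \<subseteq> I \<Longrightarrow> proj K \<in> measurable (B I) (B K)"
  by (rule measurable_into_B) (auto intro: proj_T pullback_definable Df_sets_B)

text \<open>Forgetting one coordinate is existential quantification over the corresponding variable.\<close>

lemma image_definable:
  assumes "v \<in> V" "v \<notin> K" "D \<in> Df (insert v K)"
  shows "proj K ` D \<in> Df K"
  using assms(3)
proof (rule definableE)
  fix \<phi> assume \<phi>: "is_fm L (elements L M) \<phi>" "free_vars \<phi> \<subseteq> vars (insert v K)"
      "D = {x \<in> T (insert v K). sat M (env x) \<phi>}"
  have eq: "sat M ((env y)((\<sigma> v, v) := a)) \<phi> \<longleftrightarrow> sat M (env (y(v := a))) \<phi>" for y a
  proof (rule sat_cong)
    fix w assume "w \<in> free_vars \<phi>"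
    then obtain i where "w = (\<sigma> i, i)" using \<phi>(2) by blast
    then show "((env y)((\<sigma> v, v) := a)) w = env (y(v := a)) w" by (cases "i = v") auto
  qed
  have "proj K ` D = {y \<in> T K. sat M (env y) (Exi (\<sigma> v, v) \<phi>)}"
  proof (intro set_eqI iffI)
    fix y assume "y \<in> proj K ` D"
    then obtain x where x: "x \<in> T (insert v K)" "sat M (env x) \<phi>" "y = proj K x"
      by (auto simp: \<phi>(3))
    have "y(v := x v) = x"
      using x(1,3) by (auto simp: tuples_def PiE_def extensional_def)
    then have "sat M (env (y(v := x v))) \<phi>" using x by simp
    moreover have "x v \<in> domain M (\<sigma> v)" using x(1) by (auto simp: tuples_def)
    moreover have "y \<in> T K" using x proj_T by blast
    ultimately show "y \<in> {y \<in> T K. sat M (env y) (Exi (\<sigma> v, v) \<phi>)}"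
      using eq by auto
  next
    fix y assume "y \<in> {y \<in> T K. sat M (env y) (Exi (\<sigma> v, v) \<phi>)}"
    then obtain a where y: "y \<in> T K" "a \<in> domain M (\<sigma> v)" "sat M (env (y(v := a))) \<phi>"
      using eq by auto
    have "y(v := a) \<in> T (insert v K)"
      unfolding tuples_def using y(1,2) by (intro PiE_fun_upd) (auto simp: tuples_def)
    then have "y(v := a) \<in> D" unfolding \<phi>(3) using y(3) by blast
    moreover have "proj K (y(v := a)) = y"
      using y(1) assms(2) by (auto simp: tuples_def PiE_def extensional_def)
    ultimately show "y \<in> proj K ` D" by (metis image_eqI)
  qed
  also have "\<dots> \<in> Df K" using \<phi>(1,2) assms(1) sorts by (intro definableI) auto
  finally show ?thesis .
qed

lemma slice_definable:
  assumes "H \<inter> K = {}" "H \<subseteq> V" "y \<in> T H" "D \<in> Df (K \<union> H)"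
  shows "{u \<in> T K. merge K H (u, y) \<in> D} \<in> Df K"
  using assms(4)
proof (rule definableE)
  fix \<phi> assume \<phi>: "is_fm L (elements L M) \<phi>" "free_vars \<phi> \<subseteq> vars (K \<union> H)"
      "D = {x \<in> T (K \<union> H). sat M (env x) \<phi>}"
  define \<theta> where "\<theta> = (\<lambda>(s, i). if i \<in> H \<and> s = \<sigma> i then Some (y i) else None)"
  have dom_\<theta>: "dom \<theta> = vars H" by (auto simp: \<theta>_def dom_def split: if_splits)
  have "sat M (env u) (inst \<theta> \<phi>) \<longleftrightarrow> sat M (env (merge K H (u, y))) \<phi>" for u
    unfolding sat_inst
    by (rule sat_cong) (use \<phi>(2) assms(1) in \<open>auto simp: override_def \<theta>_def merge_def\<close>)
  moreover have "merge K H (u, y) \<in> T (K \<union> H)" if "u \<in> T K" for u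
    using that assms(1,3) by (auto simp: tuples_def PiE_def Pi_def merge_def extensional_def)
  ultimately have "{u \<in> T K. merge K H (u, y) \<in> D} = {u \<in> T K. sat M (env u) (inst \<theta> \<phi>)}"
    unfolding \<phi>(3) by auto
  also have "\<dots> \<in> Df K"
  proof (rule definableI)
    show "is_fm L (elements L M) (inst \<theta> \<phi>)"
    proof (rule is_fm_inst[OF \<phi>(1)])
      fix v a assume "\<theta> v = Some a"
      then obtain i where "v = (\<sigma> i, i)" "i \<in> H" "a = y i"
        by (auto simp: \<theta>_def split: if_splits prod.splits)
      then show "(fst v, a) \<in> elements L M"
        using assms(2,3) sorts by (auto simp: elements_def tuples_def)
    qed
    show "free_vars (inst \<theta> \<phi>) \<subseteq> vars K"
      unfolding free_vars_inst dom_\<theta> using \<phi>(2) by auto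
  qed
  finally show ?thesis .
qed

text \<open>The defining formulas of a decreasing sequence form a type over the countably many parameters in
them. It is finitely satisfiable, as finitely many of the sets have the last one as their
intersection; a realization in the variables indexed by \<open>V\<close> is a common point.\<close>

lemma definable_compact:
  assumes D: "\<And>i::nat. D i \<in> Df V" and dec: "decseq D" and ne: "\<And>i. D i \<noteq> {}"
  shows "(\<Inter>i. D i) \<noteq> {}"
proof -
  have "\<forall>i. \<exists>\<phi>. is_fm L (elements L M) \<phi> \<and> free_vars \<phi> \<subseteq> vars V \<and> D i = {x \<in> T V. sat M (env x) \<phi>}"
    using D unfolding definable_sets_def by blast
  from choice[OF this] obtain \<phi> where \<phi>: "\<And>i. is_fm L (elements L M) (\<phi> i)"
    "\<And>i. free_vars (\<phi> i) \<subseteq> vars V" "\<And>i. D i = {x \<in> T V. sat M (env x) (\<phi> i)}" by blast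
  define A where "A = (\<Union>i. elements L M \<inter> params (\<phi> i))"
  have "countable A" unfolding A_def
    by (rule countable_UN, simp, rule countable_finite, simp add: finite_params)
  moreover have "A \<subseteq> elements L M" by (auto simp: A_def)
  moreover have "finite (vars V)" using finite_V by simp
  moreover have "vars V \<subseteq> sorts L \<times> UNIV" using sorts by auto
  moreover have "\<forall>\<psi>\<in>range \<phi>. is_fm L A \<psi> \<and> free_vars \<psi> \<subseteq> vars V"
    using \<phi>(1,2) by (auto simp: A_def intro: is_fm_restrict[of L "elements L M"])
  moreover have "\<forall>q. finite q \<longrightarrow> q \<subseteq> range \<phi> \<longrightarrow>
      (\<exists>e \<in> Pi (vars V) (domain M \<circ> fst). \<forall>\<psi>\<in>q. sat M e \<psi>)"
  proof (intro allI impI)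
    fix q assume q: "finite q" "q \<subseteq> range \<phi>"
    then obtain S where S: "finite S" "q = \<phi> ` S"
      using finite_subset_image[OF q] by blast
    obtain m where m: "\<And>n. n \<in> S \<Longrightarrow> n \<le> m"
      using S(1) by (auto simp: finite_nat_set_iff_bounded_le)
    obtain x where x: "x \<in> D m" using ne by auto
    have "env x \<in> Pi (vars V) (domain M \<circ> fst)"
      using x by (auto simp: \<phi>(3) tuples_def)
    moreover have "sat M (env x) (\<phi> n)" if "n \<in> S" for n
    proof -
      have "D m \<subseteq> D n" using dec m[OF that] by (auto simp: decseq_def)
      then show ?thesis using x by (auto simp: \<phi>(3)[of n])
    qed
    ultimately show "\<exists>e \<in> Pi (vars V) (domain M \<circ> fst). \<forall>\<psi>\<in>q. sat M e \<psi>"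
      using S(2) by blast
  qed
  ultimately have "\<exists>e \<in> Pi (vars V) (domain M \<circ> fst). \<forall>\<psi>\<in>range \<phi>. sat M e \<psi>"
    using saturated[unfolded aleph1_saturated_def, rule_format, of A "vars V" "range \<phi>"] by blast
  then obtain e where e: "e \<in> Pi (vars V) (domain M \<circ> fst)" "\<And>i. sat M e (\<phi> i)" by auto
  define x where "x = (\<lambda>i\<in>V. e (\<sigma> i, i))"
  have "e (\<sigma> i, i) \<in> domain M (\<sigma> i)" if "i \<in> V" for i
    using Pi_mem[OF e(1), of "(\<sigma> i, i)"] that by simp
  then have "x \<in> T V" by (auto simp: x_def tuples_def)
  moreover have "sat M (env x) (\<phi> i)" for i
  proof -
    have "sat M (env x) (\<phi> i) \<longleftrightarrow> sat M e (\<phi> i)"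
      by (rule sat_cong) (use \<phi>(2)[of i] in \<open>auto simp: x_def\<close>)
    then show ?thesis using e(2) by simp
  qed
  ultimately show ?thesis by (auto simp: \<phi>(3))
qed

lemma compact_algebra_definable: "compact_algebra (T V) (Df V)"
proof -
  interpret algebra "T V" "Df V" by (rule algebra_definable)
  show ?thesis
  proof unfold_locales
    show "(\<Inter>i. D i) \<noteq> {}" if "\<And>i::nat. D i \<in> Df V" "decseq D" "\<And>i. D i \<noteq> {}" for D
      using that by (rule definable_compact)
    show "{x} \<in> Df V" if "x \<in> T V" for x
    proof -
      have "{z \<in> T V. proj V z = x} = {x}" using that proj_self by auto
      then show ?thesis using fibre_definable[of V V x] that by simp
    qed
  qed
qed

end

section \<open>Orthogonality from the Fubini condition\<close>

locale measured_structure = sorted_structure L M \<sigma> V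
  for L :: "('s, 'f, 'r) lang" and M :: "('s, 'f, 'r, 'a) struct" and \<sigma> V +
  fixes \<nu> :: "(nat \<Rightarrow> 'a) measure"
  assumes prob_\<nu>: "prob_space \<nu>"
    and sets_\<nu>: "sets \<nu> = sets (B V)"
    and fubini: "fubini_condition L M \<sigma> V \<nu>"
begin

sublocale prob_space \<nu> by (rule prob_\<nu>)

lemma space_\<nu>: "space \<nu> = T V"
  using sets_eq_imp_space_eq[OF sets_\<nu>] by simp

abbreviation F :: "nat set \<Rightarrow> (nat \<Rightarrow> 'a) set set" where
  "F K \<equiv> sets (vimage_algebra (T V) (proj K) (B K))"

lemma F_eq:
  assumes "K \<subseteq> V" shows "F K = {{x \<in> T V. proj K x \<in> Y} |Y. Y \<in> sets (B K)}"
proof -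
  have "proj K \<in> T V \<rightarrow> space (B K)" using proj_T[OF _ assms] by auto
  then have "F K = {proj K -` Y \<inter> T V |Y. Y \<in> sets (B K)}" by (rule sets_vimage_algebra2)
  moreover have "proj K -` Y \<inter> T V = {x \<in> T V. proj K x \<in> Y}" for Y by auto
  ultimately show ?thesis by simp
qed

lemma F_I: "K \<subseteq> V \<Longrightarrow> Y \<in> sets (B K) \<Longrightarrow> {x \<in> T V. proj K x \<in> Y} \<in> F K"
  unfolding F_eq by blast

lemma measurable_Collect:
  assumes "g \<in> measurable N N'" "Y \<in> sets N'"
  shows "{x \<in> space N. g x \<in> Y} \<in> sets N"
proof -
  have "g -` Y \<inter> space N = {x \<in> space N. g x \<in> Y}" by auto
  then show ?thesis using measurable_sets[OF assms] by simp
qed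

lemma F_sets: "K \<subseteq> V \<Longrightarrow> F K \<subseteq> sets \<nu>"
  using measurable_Collect[OF measurable_proj[of K V]] unfolding F_eq sets_\<nu> by auto

lemma F_mono:
  assumes "K \<subseteq> K'" "K' \<subseteq> V" shows "F K \<subseteq> F K'"
proof
  fix X assume "X \<in> F K"
  then obtain Y where Y: "Y \<in> sets (B K)" "X = {x \<in> T V. proj K x \<in> Y}"
    using F_eq[of K] assms by auto
  have "proj K (proj K' x) = proj K x" for x :: "nat \<Rightarrow> 'a"
    using assms(1) by (simp add: restrict_restrict Int_absorb1)
  then have "X = {x \<in> T V. proj K' x \<in> {z \<in> T K'. proj K z \<in> Y}}"
    unfolding Y(2) using proj_T[OF _ assms(2)] by auto
  moreover have "{z \<in> T K'. proj K z \<in> Y} \<in> sets (B K')"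
    using measurable_Collect[OF measurable_proj[OF assms(1)] Y(1)] by simp
  ultimately show "X \<in> F K'" using assms(2) by (simp only: F_I)
qed

lemma F_empty: "F {} \<subseteq> {{}, T V}"
proof
  fix X assume "X \<in> F {}"
  then obtain Y where "X = {x \<in> T V. proj {} x \<in> Y}" using F_eq[of "{}"] by auto
  moreover have "proj {} x = (\<lambda>_. undefined)" for x :: "nat \<Rightarrow> 'a" by auto
  ultimately show "X \<in> {{}, T V}" by (cases "(\<lambda>_. undefined) \<in> Y") auto
qed

lemma measurable_merge:
  assumes "H \<inter> K = {}" "H \<subseteq> V" "y \<in> T H"
  shows "(\<lambda>u. merge K H (u, y)) \<in> measurable (B K) (B (K \<union> H))"
proof (rule measurable_into_B)
  show "merge K H (u, y) \<in> T (K \<union> H)" if "u \<in> space (B K)" for u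
    using that assms(1,3) by (auto simp: tuples_def PiE_def Pi_def merge_def extensional_def)
  show "{u \<in> space (B K). merge K H (u, y) \<in> D} \<in> sets (B K)" if "D \<in> Df (K \<union> H)" for D
    using slice_definable[OF assms that] Df_sets_B by simp
qed

text \<open>Level sets of \<open>h\<close> are preimages under \<open>proj I\<close>.\<close>

lemma measurable_F_factors:
  fixes h :: "(nat \<Rightarrow> 'a) \<Rightarrow> real"
  assumes "h \<in> borel_measurable N" "space N = T V" "sets N \<subseteq> F I" "I \<subseteq> V"
    and "x \<in> T V" "x' \<in> T V" "proj I x = proj I x'"
  shows "h x = h x'"
proof -
  have "{z \<in> space N. h z \<in> {h x}} \<in> sets N" by (rule measurable_Collect[OF assms(1)]) simp
  then have "{z \<in> T V. h z = h x} \<in> F I" using assms(2,3) by auto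
  then obtain Y where Y: "{z \<in> T V. h z = h x} = {z \<in> T V. proj I z \<in> Y}"
    using F_eq[OF assms(4)] by auto
  have "x \<in> {z \<in> T V. h z = h x}" using assms(5) by simp
  then have "x' \<in> {z \<in> T V. proj I z \<in> Y}" unfolding Y using assms(6,7) by simp
  then show ?thesis unfolding Y[symmetric] by simp
qed

text \<open>Let \<open>h\<close> be the indicator of \<open>X\<close> minus its conditional expectation; the claim is that \<open>h\<close> integrates to \<open>0\<close>
over \<open>W\<close>. By the Fubini condition one may first fix the coordinates \<open>y\<close> outside \<open>I\<close>. Then \<open>h\<close> is
unchanged, as it depends on the coordinates in \<open>I\<close> only, while a set in \<open>F K\<close> becomes, with \<open>y\<close> as
parameters, a set in \<open>F (K \<inter> I)\<close>; so \<open>W\<close> becomes a set on which \<open>h\<close> integrates to \<open>0\<close> by the definition of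
the conditional expectation. This holds for every single \<open>y\<close>.\<close>

lemma orthogonal:
  assumes I: "I \<subseteq> V" and X: "X \<in> F I"
    and W: "W \<in> join (T V) F {K. K \<subseteq> V \<and> card (K \<inter> I) \<le> j}"
  shows "measure \<nu> (X \<inter> W) =
    (\<integral>x. real_cond_exp \<nu> (sigma (T V) (\<Union>K\<in>{K. K \<subseteq> I \<and> card K \<le> j}. F K))
           (indicator X) x * indicator W x \<partial>\<nu>)"
proof -
  define \<G> where "\<G> = (\<Union>K\<in>{K. K \<subseteq> I \<and> card K \<le> j}. F K)"
  define \<H> where "\<H> = (\<Union>K\<in>{K. K \<subseteq> V \<and> card (K \<inter> I) \<le> j}. F K)"
  define Lo where "Lo = sigma (T V) \<G>"
  have F_Pow: "F K \<subseteq> Pow (T V)" for K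
    using sets.space_closed[of "vimage_algebra (T V) (proj K) (B K)"] by simp
  have \<G>_Pow: "\<G> \<subseteq> Pow (T V)" and \<H>_Pow: "\<H> \<subseteq> Pow (T V)"
    using F_Pow unfolding \<G>_def \<H>_def by blast+
  have space_Lo: "space Lo = T V" and sets_Lo: "sets Lo = sigma_sets (T V) \<G>"
    using \<G>_Pow by (simp_all add: Lo_def)
  have "\<G> \<subseteq> F I" using F_mono[OF _ I] unfolding \<G>_def by blast
  then have Lo_F: "sets Lo \<subseteq> F I"
    unfolding sets_Lo
    using sets.sigma_sets_subset[of \<G> "vimage_algebra (T V) (proj I) (B I)"] by simp
  then have Lo_\<nu>: "sets Lo \<subseteq> sets \<nu>" using F_sets[OF I] by blast
  have "\<H> \<subseteq> sets \<nu>" using F_sets unfolding \<H>_def by blast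
  then have W_\<nu>: "W \<in> sets \<nu>"
    using W sets.sigma_sets_subset[of \<H> \<nu>] unfolding join_def \<H>_def space_\<nu> by blast
  have X_\<nu>: "X \<in> sets \<nu>" using X F_sets[OF I] by blast
  have subalg: "subalgebra \<nu> Lo" unfolding subalgebra_def using space_\<nu> space_Lo Lo_\<nu> by simp
  interpret S: finite_measure_subalgebra \<nu> Lo by unfold_locales (rule subalg)
  define g where "g = real_cond_exp \<nu> Lo (indicator X)"
  define h where "h x = indicator X x - g x" for x
  have int_X: "integrable \<nu> (indicator X :: _ \<Rightarrow> real)"
    using X_\<nu> by (intro integrable_real_indicator) (auto simp: less_top[symmetric])
  have g_Lo: "g \<in> borel_measurable Lo" by (simp add: g_def)
  then have g_\<nu> [measurable]: "g \<in> borel_measurable \<nu>" by (rule measurable_from_subalg[OF subalg])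
  have int_g: "integrable \<nu> g" unfolding g_def using int_X by (rule S.real_cond_exp_int)
  have "AE x in \<nu>. g x \<ge> 0"
    unfolding g_def by (rule S.real_cond_exp_ge_c[OF int_X]) (auto simp: indicator_def)
  moreover have "AE x in \<nu>. g x \<le> 1"
    unfolding g_def by (rule S.real_cond_exp_le_c[OF int_X]) (auto simp: indicator_def)
  ultimately have bound: "AE x in \<nu>. \<bar>h x * indicator W x\<bar> \<le> 1"
    by eventually_elim (auto simp: h_def indicator_def)

  have h_F: "h \<in> borel_measurable (vimage_algebra (T V) (proj I) (B I))"
  proof -
    have "g \<in> borel_measurable (vimage_algebra (T V) (proj I) (B I))"
      using g_Lo by (rule measurable_from_subalg[rotated]) (simp add: subalgebra_def space_Lo Lo_F)
    then show ?thesis unfolding h_def[abs_def] using X by measurable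
  qed
  have h_eq: "h x = h x'" if "x \<in> T V" "x' \<in> T V" "proj I x = proj I x'" for x x'
    by (rule measurable_F_factors[OF h_F _ _ I that]) auto
  have h_\<nu> [measurable]: "h \<in> borel_measurable \<nu>" unfolding h_def[abs_def] using X_\<nu> by measurable
  have f_B: "(\<lambda>x. h x * indicator W x) \<in> borel_measurable (B V)"
  proof -
    have "(\<lambda>x. h x * indicator W x) \<in> borel_measurable \<nu>" using W_\<nu> by measurable
    then show ?thesis by (simp only: measurable_cong_sets[OF sets_\<nu> refl])
  qed

  have inner: "(\<integral>x. h (merge I (V - I) (x, y)) * indicator W (merge I (V - I) (x, y)) \<partial>marginal L M \<sigma> \<nu> I) = 0"
    if y: "y \<in> T (V - I)" for y
  proof -
    have VI: "I \<union> (V - I) = V" using I by auto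
    have merge_B: "(\<lambda>u. merge I (V - I) (u, y)) \<in> measurable (B I) (B V)"
      using measurable_merge[of "V - I" I y] y VI by auto
    define \<Phi> where "\<Phi> z = merge I (V - I) (proj I z, y)" for z
    have \<Phi>_T: "\<Phi> z \<in> T V" if "z \<in> T V" for z
      using measurable_space[OF merge_B, of "proj I z"] proj_T[OF that I] by (simp add: \<Phi>_def)
    have \<Phi>_proj: "proj I (\<Phi> z) = proj I z" for z
      by (rule ext) (simp add: \<Phi>_def merge_def restrict_def)
    define W' where "W' = {z \<in> T V. \<Phi> z \<in> W}"
    have "\<Phi> \<in> measurable Lo (sigma (T V) \<H>)"
    proof (rule measurable_sigma_sets[OF _ \<H>_Pow])
      show "sets (sigma (T V) \<H>) = sigma_sets (T V) \<H>" using \<H>_Pow by simp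
      show "\<Phi> \<in> space Lo \<rightarrow> T V" using \<Phi>_T by (simp add: space_Lo)
      fix D assume "D \<in> \<H>"
      then obtain K where K: "K \<subseteq> V" "card (K \<inter> I) \<le> j" "D \<in> F K" by (auto simp: \<H>_def)
      then obtain Y where Y: "Y \<in> sets (B K)" "D = {x \<in> T V. proj K x \<in> Y}"
        using F_eq[of K] by auto
      define Y' where "Y' = {u \<in> space (B (K \<inter> I)). merge (K \<inter> I) (K - I) (u, proj (K - I) y) \<in> Y}"
      have "(K \<inter> I) \<union> (K - I) = K" by auto
      moreover have "proj (K - I) y \<in> T (K - I)" using K(1) by (intro proj_T[OF y]) auto
      ultimately have "(\<lambda>u. merge (K \<inter> I) (K - I) (u, proj (K - I) y)) \<in> measurable (B (K \<inter> I)) (B K)"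
        using measurable_merge[of "K - I" "K \<inter> I" "proj (K - I) y"] K(1) by auto
      then have "Y' \<in> sets (B (K \<inter> I))" unfolding Y'_def using Y(1) by (rule measurable_Collect)
      then have "{z \<in> T V. proj (K \<inter> I) z \<in> Y'} \<in> F (K \<inter> I)" using K(1) by (intro F_I) auto
      then have in_Lo: "{z \<in> T V. proj (K \<inter> I) z \<in> Y'} \<in> sets Lo"
        unfolding sets_Lo \<G>_def using K(2) by (intro sigma_sets.Basic) auto
      have "proj K (\<Phi> z) = merge (K \<inter> I) (K - I) (proj (K \<inter> I) z, proj (K - I) y)" for z
        by (rule ext) (use K(1) in \<open>auto simp: \<Phi>_def merge_def restrict_def\<close>)
      then have "\<Phi> -` D \<inter> space Lo = {z \<in> T V. proj (K \<inter> I) z \<in> Y'}"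
        using \<Phi>_T proj_T[of _ V "K \<inter> I"] K(1) by (auto simp: Y(2) Y'_def space_Lo)
      then show "\<Phi> -` D \<inter> space Lo \<in> sets Lo" using in_Lo by simp
    qed
    moreover have "W \<in> sets (sigma (T V) \<H>)"
      using W \<H>_Pow by (simp add: join_def \<H>_def)
    ultimately have "{z \<in> space Lo. \<Phi> z \<in> W} \<in> sets Lo" by (rule measurable_Collect)
    then have W'_Lo: "W' \<in> sets Lo" by (simp add: W'_def space_Lo)
    have W'_\<nu>: "W' \<in> sets \<nu>" using W'_Lo Lo_\<nu> by blast
    have int_W': "integrable \<nu> (\<lambda>z. indicator W' z * f z)" if "integrable \<nu> f"
      for f :: "(nat \<Rightarrow> 'a) \<Rightarrow> real"
      using integrable_mult_indicator[OF W'_\<nu> that] by simp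

    have proj_\<nu>: "proj I \<in> measurable \<nu> (B I)"
      by (simp only: measurable_cong_sets[OF sets_\<nu> refl] measurable_proj[OF I])
    have "(\<integral>x. h (merge I (V - I) (x, y)) * indicator W (merge I (V - I) (x, y)) \<partial>marginal L M \<sigma> \<nu> I)
        = (\<integral>z. h (\<Phi> z) * indicator W (\<Phi> z) \<partial>\<nu>)"
      unfolding marginal_def \<Phi>_def
      by (rule integral_distr[OF proj_\<nu> measurable_compose[OF merge_B f_B]])
    also have "\<dots> = (\<integral>z. indicator W' z * indicator X z - indicator W' z * g z \<partial>\<nu>)"
    proof (rule Bochner_Integration.integral_cong[OF refl])
      fix z assume "z \<in> space \<nu>"
      then have z: "z \<in> T V" by (simp add: space_\<nu>)
      have "h (\<Phi> z) = h z" by (rule h_eq[OF \<Phi>_T[OF z] z \<Phi>_proj])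
      then show "h (\<Phi> z) * indicator W (\<Phi> z)
          = indicator W' z * indicator X z - indicator W' z * g z"
        using z by (simp add: h_def W'_def indicator_def)
    qed
    also have "\<dots> = (\<integral>z. indicator W' z * indicator X z \<partial>\<nu>) - (\<integral>z. indicator W' z * g z \<partial>\<nu>)"
      by (rule Bochner_Integration.integral_diff[OF int_W'[OF int_X] int_W'[OF int_g]])
    also have "(\<integral>z. indicator W' z * g z \<partial>\<nu>) = (\<integral>z. indicator W' z * indicator X z \<partial>\<nu>)"
      unfolding g_def
    proof (rule S.real_cond_exp_intg(2))
      show "integrable \<nu> (\<lambda>z. indicator W' z * indicator X z :: real)"
        by (rule int_W'[OF int_X])
    qed (use W'_Lo X_\<nu> in auto)
    finally show ?thesis by simp
  qed
  have "(\<integral>x. h x * indicator W x \<partial>\<nu>) =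
      (\<integral>y. (\<integral>x. h (merge I (V - I) (x, y)) * indicator W (merge I (V - I) (x, y)) \<partial>marginal L M \<sigma> \<nu> I)
         \<partial>marginal L M \<sigma> \<nu> (V - I))"
    using fubini[unfolded fubini_condition_def, rule_format, OF I f_B] bound by blast
  also have "\<dots> = (\<integral>y. 0 \<partial>marginal L M \<sigma> \<nu> (V - I))"
  proof (rule Bochner_Integration.integral_cong[OF refl])
    fix y assume "y \<in> space (marginal L M \<sigma> \<nu> (V - I))"
    then have "y \<in> T (V - I)" by (simp add: marginal_def)
    then show "(\<integral>x. h (merge I (V - I) (x, y)) * indicator W (merge I (V - I) (x, y))
        \<partial>marginal L M \<sigma> \<nu> I) = 0" by (rule inner)
  qed
  finally have zero: "(\<integral>x. h x * indicator W x \<partial>\<nu>) = 0" by simp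
  have "(\<integral>x. h x * indicator W x \<partial>\<nu>) =
      (\<integral>x. indicator (X \<inter> W) x - g x * indicator W x \<partial>\<nu>)"
    by (rule Bochner_Integration.integral_cong[OF refl]) (auto simp: h_def indicator_def)
  also have "\<dots> = (\<integral>x. indicator (X \<inter> W) x \<partial>\<nu>) - (\<integral>x. g x * indicator W x \<partial>\<nu>)"
    using W_\<nu> X_\<nu> int_g
    by (intro Bochner_Integration.integral_diff integrable_real_mult_indicator
        integrable_real_indicator) (auto simp: less_top[symmetric])
  finally have "measure \<nu> (X \<inter> W) = (\<integral>x. g x * indicator W x \<partial>\<nu>)"
    using zero W_\<nu> X_\<nu> by simp
  then show ?thesis unfolding g_def Lo_def \<G>_def .
qed

lemma interacting_algebras_F: "interacting_algebras \<nu> V F"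
proof (intro interacting_algebras.intro interacting_algebras_axioms.intro prob_\<nu> finite_V)
  show "sigma_algebra (space \<nu>) (F K)" if "K \<subseteq> V" for K
    using sets.sigma_algebra_axioms[of "vimage_algebra (T V) (proj K) (B K)"] by (simp add: space_\<nu>)
  show "F K \<subseteq> sets \<nu>" if "K \<subseteq> V" for K using that by (rule F_sets)
  show "F K \<subseteq> F K'" if "K \<subseteq> K'" "K' \<subseteq> V" for K K' using that by (rule F_mono)
  show "F {} \<subseteq> {{}, space \<nu>}" using F_empty by (simp only: space_\<nu>)
qed (simp only: space_\<nu> orthogonal)

end

section \<open>Projections of a set with bounded fibres\<close>

text \<open>Over a base point \<open>y\<close> of the right-hand side, the sets of points of \<open>X i \<inter> E\<close> above \<open>y\<close> are finite, nonempty and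
decreasing.\<close>

lemma image_decseq_finite_fibres:
  assumes "decseq X" "\<And>y. finite {x \<in> E. \<pi> x = y}"
  shows "\<pi> ` ((\<Inter>i. X i) \<inter> E) = (\<Inter>i. \<pi> ` (X i \<inter> E))"
proof
  show "(\<Inter>i. \<pi> ` (X i \<inter> E)) \<subseteq> \<pi> ` ((\<Inter>i. X i) \<inter> E)"
  proof
    fix y assume y: "y \<in> (\<Inter>i. \<pi> ` (X i \<inter> E))"
    define K where "K m = {x \<in> X m \<inter> E. \<pi> x = y}" for m
    have "(\<Inter>m. K m) \<noteq> {}"
    proof (rule decreasing_finite_Inter_nonempty)
      show "finite (K m)" for m
        using assms(2)[of y] by (rule finite_subset[rotated]) (auto simp: K_def)
      show "K m \<noteq> {}" for m using y by (auto simp: K_def)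
      show "decseq K"
      proof (unfold decseq_def, intro allI impI)
        fix m n :: nat assume "m \<le> n"
        then have "X n \<subseteq> X m" using assms(1) by (auto simp: decseq_def)
        then show "K n \<subseteq> K m" unfolding K_def by auto
      qed
    qed
    then obtain x where "\<And>m. x \<in> K m" by auto
    then show "y \<in> \<pi> ` ((\<Inter>i. X i) \<inter> E)" by (auto simp: K_def)
  qed
qed auto

context measured_structure
begin

abbreviation marg :: "nat set \<Rightarrow> (nat \<Rightarrow> 'a) measure" where "marg \<equiv> marginal L M \<sigma> \<nu>"

lemma proj_measurable_\<nu>: "I \<subseteq> V \<Longrightarrow> proj I \<in> measurable \<nu> (B I)"
  by (simp only: measurable_cong_sets[OF sets_\<nu> refl] measurable_proj)

lemma sets_marg [simp]: "sets (marg I) = sets (B I)"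
  by (simp add: marginal_def)

lemma prob_space_marg: "I \<subseteq> V \<Longrightarrow> prob_space (marg I)"
  unfolding marginal_def by (rule prob_space_distr) (rule proj_measurable_\<nu>)

lemma measure_marg:
  assumes "I \<subseteq> V" "Y \<in> sets (B I)"
  shows "measure (marg I) Y = measure \<nu> {x \<in> T V. proj I x \<in> Y}"
proof -
  have "measure (marg I) Y = measure \<nu> (proj I -` Y \<inter> space \<nu>)"
    unfolding marginal_def by (rule measure_distr[OF proj_measurable_\<nu>[OF assms(1)] assms(2)])
  also have "proj I -` Y \<inter> space \<nu> = {x \<in> T V. proj I x \<in> Y}" by (auto simp: space_\<nu>)
  finally show ?thesis .
qed

lemma image_proj_sets:
  assumes v: "v \<in> V" and I: "I = V - {v}" and E: "E \<in> sets (B V)" and X: "X \<in> sets (B V)"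
    and l: "\<And>y. y \<in> T I \<Longrightarrow> finite {x \<in> E. proj I x = y} \<and> card {x \<in> E. proj I x = y} \<le> l"
  shows "proj I ` (X \<inter> E) \<in> sets (B I)"
proof -
  interpret C: compact_algebra "T V" "Df V" by (rule compact_algebra_definable)
  have IV: "I \<subseteq> V" "insert v I = V" "v \<notin> I" using v I by auto
  show ?thesis
  proof (rule C.finite_to_one_image)
    show "sigma_algebra (T I) (sets (B I))"
      using sets.sigma_algebra_axioms[of "B I"] by simp
    show "proj I x \<in> T I" if "x \<in> T V" for x using proj_T[OF that IV(1)] .
    show "{x \<in> T V. proj I x = y} \<in> Df V" if "y \<in> T I" for y
      using fibre_definable[OF IV(1) _ that] by simp
    show "proj I ` D \<in> sets (B I)" if "D \<in> Df V" for D
      using image_definable[OF v IV(3), of D] that IV(2) Df_sets_B by simp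
    show "X \<inter> E \<in> sigma_sets (T V) (Df V)" using sets.Int[OF X E] by (simp add: sets_B)
    fix y assume y: "y \<in> T I"
    have "{x \<in> X \<inter> E. proj I x = y} \<subseteq> {x \<in> E. proj I x = y}" by auto
    then show "finite {x \<in> X \<inter> E. proj I x = y} \<and> card {x \<in> X \<inter> E. proj I x = y} \<le> l"
      using l[OF y] by (meson card_mono finite_subset order_trans)
  qed
qed

lemma finite_fibre:
  assumes "I \<subseteq> V" "E \<subseteq> T V" "\<And>y. y \<in> T I \<Longrightarrow> finite {x \<in> E. proj I x = y}"
  shows "finite {x \<in> E. proj I x = y}"
proof (cases "y \<in> T I")
  case False
  then have "{x \<in> E. proj I x = y} = {}" using assms(2) proj_T[OF _ assms(1)] by blast
  then show ?thesis by (simp only: finite.emptyI)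
qed (rule assms(3))

text \<open>Finite fibres make both sides continuous along increasing and decreasing sequences in \<open>G\<close>, so the
inequality extends from definable sets to the \<open>\<sigma>\<close>-algebra that they generate.\<close>

lemma image_measure_le:
  assumes v: "v \<in> V" "v' \<in> V" and J: "J = V - {v}" and I: "I = V - {v'}" and E: "E \<in> sets (B V)"
    and lJ: "\<And>y. y \<in> T J \<Longrightarrow> finite {x \<in> E. proj J x = y} \<and> card {x \<in> E. proj J x = y} \<le> l"
    and lI: "\<And>y. y \<in> T I \<Longrightarrow> finite {x \<in> E. proj I x = y} \<and> card {x \<in> E. proj I x = y} \<le> l"
    and le: "\<And>D. D \<in> Df V \<Longrightarrow>
      measure (marg J) (proj J ` (D \<inter> E)) \<le> k * measure (marg I) (proj I ` (D \<inter> E))"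
    and G: "G \<in> sets (B V)"
  shows "measure (marg J) (proj J ` (G \<inter> E)) \<le> k * measure (marg I) (proj I ` (G \<inter> E))"
proof -
  have JV: "J \<subseteq> V" and IV: "I \<subseteq> V" using J I by auto
  interpret mJ: prob_space "marg J" using prob_space_marg JV .
  interpret mI: prob_space "marg I" using prob_space_marg IV .
  interpret algebra "T V" "Df V" by (rule algebra_definable)
  have E_T: "E \<subseteq> T V" using sets.sets_into_space[OF E] by simp
  have img_J: "proj J ` (X \<inter> E) \<in> sets (marg J)" if "X \<in> sets (B V)" for X
    using image_proj_sets[OF v(1) J E that lJ] by simp
  have img_I: "proj I ` (X \<inter> E) \<in> sets (marg I)" if "X \<in> sets (B V)" for X
    using image_proj_sets[OF v(2) I E that lI] by simp
  have fin: "finite {x \<in> E. proj J x = y}" "finite {x \<in> E. proj I x = y}" for y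
    using lJ lI by (auto intro: finite_fibre[OF JV E_T] finite_fibre[OF IV E_T])
  have "G \<in> sigma_sets (T V) (Df V)" using G by (simp add: sets_B)
  then show ?thesis
  proof (induction rule: monotone_class_induct)
    case (basic D)
    then show ?case by (rule le)
  next
    case (inc X)
    have X: "X i \<in> sets (B V)" for i using inc.hyps(1) by (simp add: sets_B)
    have mono: "incseq (\<lambda>i. proj H ` (X i \<inter> E))" for H
      unfolding incseq_def
      by (intro allI impI image_mono Int_mono order_refl) (rule incseqD[OF inc.hyps(2)])
    have lim: "(\<lambda>i. measure (marg J) (proj J ` (X i \<inter> E))) \<longlonglongrightarrow>
        measure (marg J) (\<Union>i. proj J ` (X i \<inter> E))"
      using img_J[OF X] mono
      by (intro mJ.finite_Lim_measure_incseq) auto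
    have lim': "(\<lambda>i. k * measure (marg I) (proj I ` (X i \<inter> E))) \<longlonglongrightarrow>
        k * measure (marg I) (\<Union>i. proj I ` (X i \<inter> E))"
      using img_I[OF X] mono
      by (intro tendsto_mult_left mI.finite_Lim_measure_incseq) auto
    have "measure (marg J) (\<Union>i. proj J ` (X i \<inter> E)) \<le> k * measure (marg I) (\<Union>i. proj I ` (X i \<inter> E))"
      by (rule LIMSEQ_le[OF lim lim']) (intro exI[of _ 0] allI impI inc.IH)
    moreover have "proj J ` ((\<Union>i. X i) \<inter> E) = (\<Union>i. proj J ` (X i \<inter> E))"
      "proj I ` ((\<Union>i. X i) \<inter> E) = (\<Union>i. proj I ` (X i \<inter> E))" by auto
    ultimately show ?case by (simp only:)
  next
    case (dec X)
    have X: "X i \<in> sets (B V)" for i using dec.hyps(1) by (simp add: sets_B)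
    have mono: "decseq (\<lambda>i. proj H ` (X i \<inter> E))" for H
      unfolding decseq_def
      by (intro allI impI image_mono Int_mono order_refl) (rule decseqD[OF dec.hyps(2)])
    have lim: "(\<lambda>i. measure (marg J) (proj J ` (X i \<inter> E))) \<longlonglongrightarrow>
        measure (marg J) (\<Inter>i. proj J ` (X i \<inter> E))"
      using img_J[OF X] mono
      by (intro mJ.finite_Lim_measure_decseq) auto
    have lim': "(\<lambda>i. k * measure (marg I) (proj I ` (X i \<inter> E))) \<longlonglongrightarrow>
        k * measure (marg I) (\<Inter>i. proj I ` (X i \<inter> E))"
      using img_I[OF X] mono
      by (intro tendsto_mult_left mI.finite_Lim_measure_decseq) auto
    have "measure (marg J) (\<Inter>i. proj J ` (X i \<inter> E)) \<le> k * measure (marg I) (\<Inter>i. proj I ` (X i \<inter> E))"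
      by (rule LIMSEQ_le[OF lim lim']) (intro exI[of _ 0] allI impI dec.IH)
    then show ?case
      by (simp only: image_decseq_finite_fibres[OF dec.hyps(2) fin(1)]
          image_decseq_finite_fibres[OF dec.hyps(2) fin(2)])
  qed
qed

text \<open>The submeasure \<open>\<mu>\<close> lives on \<open>E\<close>, which is contained in the set of simplices \<open>(\<Inter>I\<in>\<J>. A I)\<close>, so \<open>\<mu>\<close> charges it;
by \<open>removal\<close> it cannot be \<open>\<nu>\<close>-null.\<close>

lemma simplices_positive:
  fixes E :: "(nat \<Rightarrow> 'a) set" and k :: real and l :: nat
  defines "\<J> \<equiv> (\<lambda>v. V - {v}) ` V"
  assumes J: "J \<in> \<J>" and E: "E \<in> sets (B V)"
    and pos: "measure (marg J) (proj J ` E) > 0"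
    and l: "\<And>I y. I \<in> \<J> \<Longrightarrow> y \<in> T I \<Longrightarrow>
      finite {x \<in> E. proj I x = y} \<and> card {x \<in> E. proj I x = y} \<le> l"
    and "k > 0"
    and k: "\<And>D I. D \<in> Df V \<Longrightarrow> I \<in> \<J> \<Longrightarrow>
      measure (marg J) (proj J ` (D \<inter> E)) \<le> k * measure (marg I) (proj I ` (D \<inter> E))"
  shows "measure \<nu> {x \<in> T V. \<forall>I\<in>\<J>. proj I x \<in> proj I ` E} > 0"
proof -
  define \<mu> where "\<mu> X = measure (marg J) (proj J ` (X \<inter> E))" for X
  obtain v where v: "v \<in> V" "J = V - {v}" using J by (auto simp: \<J>_def)
  have JV: "J \<subseteq> V" using v by auto
  interpret mJ: prob_space "marg J" using prob_space_marg JV .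
  have \<J>_V: "I \<subseteq> V" if "I \<in> \<J>" for I using that by (auto simp: \<J>_def)
  have E_T: "E \<subseteq> T V" using sets.sets_into_space[OF E] by simp
  have img: "proj I ` (X \<inter> E) \<in> sets (B I)" if "X \<in> sets (B V)" "I \<in> \<J>" for X I
  proof -
    obtain w where w: "w \<in> V" "I = V - {w}" using \<open>I \<in> \<J>\<close> by (auto simp: \<J>_def)
    show ?thesis by (rule image_proj_sets[OF w E that(1) l[OF that(2)]])
  qed
  interpret interacting_algebras \<nu> V F by (rule interacting_algebras_F)
  interpret controlled_submeasure \<nu> V F \<J> \<mu> k
  proof unfold_locales
    show "\<J> \<subseteq> Pow V" using \<J>_V by auto
    show "\<J> \<noteq> {}" using J by auto
    show "\<mu> A \<le> \<mu> A'" if "A \<in> sets \<nu>" "A' \<in> sets \<nu>" "A \<subseteq> A'" for A A'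
      unfolding \<mu>_def using img[OF _ J] that sets_\<nu>
      by (intro mJ.finite_measure_mono) auto
    show "\<mu> (A \<union> A') \<le> \<mu> A + \<mu> A'" if "A \<in> sets \<nu>" "A' \<in> sets \<nu>" for A A'
    proof -
      have "proj J ` ((A \<union> A') \<inter> E) = proj J ` (A \<inter> E) \<union> proj J ` (A' \<inter> E)" by auto
      then show ?thesis
        unfolding \<mu>_def using img[OF _ J] that sets_\<nu> by (simp only:) (intro measure_Un_le, auto)
    qed
    show "\<mu> A \<le> k * measure \<nu> A" if I: "I \<in> \<J>" and A: "A \<in> F I" for I A
    proof -
      interpret mI: prob_space "marg I" using prob_space_marg \<J>_V[OF I] .
      obtain w where w: "w \<in> V" "I = V - {w}" using I by (auto simp: \<J>_def)
      obtain Y where Y: "Y \<in> sets (B I)" "A = {x \<in> T V. proj I x \<in> Y}"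
        using A F_eq[OF \<J>_V[OF I]] by auto
      have A_B: "A \<in> sets (B V)" using A F_sets[OF \<J>_V[OF I]] sets_\<nu> by blast
      have "\<mu> A \<le> k * measure (marg I) (proj I ` (A \<inter> E))"
        unfolding \<mu>_def
        by (rule image_measure_le[OF v(1) w(1) v(2) w(2) E l[OF J] l[OF I] k[OF _ I] A_B])
      also have "\<dots> \<le> k * measure (marg I) Y"
        using Y \<open>k > 0\<close> by (intro mult_left_mono mI.finite_measure_mono) auto
      also have "\<dots> = k * measure \<nu> A" using measure_marg[OF \<J>_V[OF I] Y(1)] Y(2) by simp
      finally show ?thesis .
    qed
    show "k > 0" by fact
  qed
  define A where "A I = {x \<in> T V. proj I x \<in> proj I ` E}" for I
  have A_F: "A I \<in> F I" if "I \<in> \<J>" for I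
    unfolding A_def using img[of "T V" I] that \<J>_V E_T sets.top[of "B V"]
    by (intro F_I) (auto simp: Int_absorb1)
  have "E \<subseteq> (\<Inter>I\<in>\<J>. A I)" using E_T by (auto simp: A_def)
  then have "\<mu> (\<Inter>I\<in>\<J>. A I) = measure (marg J) (proj J ` E)"
    by (simp add: \<mu>_def Int_absorb1)
  then have "measure \<nu> (\<Inter>I\<in>\<J>. A I) \<noteq> 0" using removal[of A] A_F pos by fastforce
  moreover have "(\<Inter>I\<in>\<J>. A I) = {x \<in> T V. \<forall>I\<in>\<J>. proj I x \<in> proj I ` E}"
    using J by (auto simp: A_def)
  ultimately show ?thesis by (simp add: less_le)
qed

end

theorem theorem2p4:
  fixes L :: "('s, 'f, 'r) lang"
    and M :: "('s, 'f, 'r, 'a) struct"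
    and \<sigma> :: "nat \<Rightarrow> 's"
    and n :: nat
    and V J :: "nat set"
    and \<J> :: "nat set set"
    and \<nu> :: "(nat \<Rightarrow> 'a) measure"
    and E :: "(nat \<Rightarrow> 'a) set"
  assumes "countable_language L"
    and "is_structure L M"
    and "aleph1_saturated L M"
    and "n \<ge> 1"
    and V: "V = {1..n}"
    and J: "J = {1..n - 1}"
    and \<J>: "\<J> = {I. I \<subseteq> V \<and> card I = n - 1}"
    and "\<forall>i\<in>V. \<sigma> i \<in> sorts L"
    and "prob_space \<nu>"
    and "sets \<nu> = sets (definable_algebra L M \<sigma> V)"
    and "definability_condition L M \<sigma> V \<nu>"
    and "fubini_condition L M \<sigma> V \<nu>"
    and "E \<in> sets (definable_algebra L M \<sigma> V)"
    and a: "measure (marginal L M \<sigma> \<nu> J) (proj J ` E) > 0"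
    and b: "\<exists>l::nat. \<forall>I\<in>\<J>. \<forall>c\<in>tuples M \<sigma> I.
              finite {x \<in> E. proj I x = c} \<and> card {x \<in> E. proj I x = c} \<le> l"
    and c: "\<exists>k::real. k > 0 \<and>
              (\<forall>F\<in>definable_sets L M \<sigma> V. \<forall>I\<in>\<J>.
                 measure (marginal L M \<sigma> \<nu> J) (proj J ` (F \<inter> E))
                   \<le> k * measure (marginal L M \<sigma> \<nu> I) (proj I ` (F \<inter> E)))"
  shows "measure \<nu> {x \<in> tuples M \<sigma> V. \<forall>I\<in>\<J>. proj I x \<in> proj I ` E} > 0"
proof -
  interpret measured_structure L M \<sigma> V \<nu>
    by (intro measured_structure.intro sorted_structure.intro measured_structure_axioms.intro)
      (use assms in auto)
  have \<J>_eq: "\<J> = (\<lambda>v. V - {v}) ` V"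
  proof (intro set_eqI iffI)
    fix I assume "I \<in> \<J>"
    then have I: "I \<subseteq> V" "card I = n - 1" by (auto simp: \<J>)
    then have "card (V - I) = 1" using V \<open>n \<ge> 1\<close> by (simp add: card_Diff_subset finite_subset)
    then obtain v where "V - I = {v}" by (auto simp: card_1_singleton_iff)
    then have "v \<in> V" "I = V - {v}" using I(1) by auto
    then show "I \<in> (\<lambda>v. V - {v}) ` V" by auto
  next
    fix I assume "I \<in> (\<lambda>v. V - {v}) ` V"
    then show "I \<in> \<J>" using V by (auto simp: \<J>)
  qed
  have J_in: "J \<in> (\<lambda>v. V - {v}) ` V"
    using V J \<open>n \<ge> 1\<close> by (intro image_eqI[of _ _ n]) auto
  obtain l where l: "\<forall>I\<in>\<J>. \<forall>c\<in>tuples M \<sigma> I.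
      finite {x \<in> E. proj I x = c} \<and> card {x \<in> E. proj I x = c} \<le> l" using b by blast
  obtain k where k: "k > 0" "\<forall>F\<in>definable_sets L M \<sigma> V. \<forall>I\<in>\<J>.
      measure (marginal L M \<sigma> \<nu> J) (proj J ` (F \<inter> E))
        \<le> k * measure (marginal L M \<sigma> \<nu> I) (proj I ` (F \<inter> E))" using c by blast
  show ?thesis
    unfolding \<J>_eq
    by (rule simplices_positive[OF J_in _ a _ k(1)])
      (use l k(2) \<J>_eq \<open>E \<in> sets (definable_algebra L M \<sigma> V)\<close> in auto)
qed

end
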